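(* Let $P$ be a poset with cover graph $G$ and let $m=\mathrm{td}_2(G)$. Then $P$ has dimension at most $2^{m+1}-2$.
   Context: Posets and graphs are finite; graphs are simple and undirected; connected graphs are nonempty. For elements $x,y$ of a poset $P$, $y$ covers $x$ if $x<y$ in $P$ and there is no $z$ with $x<z<y$ in $P$. The cover graph of $P$ is the graph on the ground set of $P$ in which two vertices are adjacent if one of them covers the other in $P$. A realizer of $P$ is a set $\{\le_1,\dots,\le_d\}$ of linear orders on the ground set of $P$ such that for any two elements $x,y$ of $P$, $x\le y$ in $P$ if and only if $x\le_i y$ for every $i\in\{1,\dots,d\}$. The dimension of $P$ is the least size of a realizer of $P$. A cutvertex of a graph $G$ is a vertex $v$ such that $G-v$ has more connected components than $G$. A $2$-connected centered coloring of $G$ is a vertex coloring of $G$ such that for every connected subgraph $H$ of $G$ having no cutvertex, some color is assigned to exactly one vertex of $H$; $\mathrm{td}_2(G)$ is the minimum number of colors in a $2$-connected centered coloring of $G$. *)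

theory Defs
  imports "Graph_Theory.Graph_Theory"
begin

section \<open>Finite posets: covers, cover graph, realizers, dimension\<close>

text \<open>A poset is a ground set \<open>P\<close> with a relation \<open>r\<close> such that \<^const>\<open>partial_order_on\<close> holds
  of \<open>P\<close> and \<open>r\<close>; the pair \<open>(x, y) \<in> r\<close> stands for \<open>x \<le> y\<close>.\<close>

definition covers :: "'a set \<Rightarrow> 'a rel \<Rightarrow> 'a \<Rightarrow> 'a \<Rightarrow> bool" where
  "covers P r y x \<longleftrightarrow> x \<in> P \<and> y \<in> P \<and> (x, y) \<in> r \<and> x \<noteq> y \<and>
     \<not> (\<exists>z\<in>P. (x, z) \<in> r \<and> x \<noteq> z \<and> (z, y) \<in> r \<and> z \<noteq> y)"

text \<open>As everywhere in the graph library, an undirected simple graph is a symmetric loopless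
  digraph: the edge between \<open>x\<close> and \<open>y\<close> is the pair of arcs \<open>(x, y)\<close>, \<open>(y, x)\<close>.\<close>

definition cover_graph :: "'a set \<Rightarrow> 'a rel \<Rightarrow> 'a pair_pre_digraph" where
  "cover_graph P r = \<lparr> pverts = P, parcs = {(x, y). covers P r y x \<or> covers P r x y} \<rparr>"

text \<open>The empty family is admitted as a realizer, so posets with at most one element have
  dimension 0.\<close>

definition realizer :: "'a set \<Rightarrow> 'a rel \<Rightarrow> 'a rel set \<Rightarrow> bool" where
  "realizer P r L \<longleftrightarrow> finite L \<and> (\<forall>l\<in>L. linear_order_on P l) \<and>
     (\<forall>x\<in>P. \<forall>y\<in>P. (x, y) \<in> r \<longleftrightarrow> (\<forall>l\<in>L. (x, y) \<in> l))"

definition poset_dim :: "'a set \<Rightarrow> 'a rel \<Rightarrow> nat" where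
  "poset_dim P r = (LEAST d. \<exists>L. realizer P r L \<and> card L = d)"

section \<open>Cutvertices and 2-connected centered colorings\<close>

text \<open>In a symmetric digraph the strongly connected components, \<^const>\<open>pre_digraph.sccs\<close>, are the
  connected components of the undirected graph.\<close>

definition cutvertex :: "('a, 'b) pre_digraph \<Rightarrow> 'a \<Rightarrow> bool" where
  "cutvertex G v \<longleftrightarrow> v \<in> verts G \<and>
     card (pre_digraph.sccs (pre_digraph.del_vert G v)) > card (pre_digraph.sccs G)"

text \<open>The locale predicate \<^const>\<open>graph\<close> restricts the library's subgraphs to the undirected ones.
  A connected graph is nonempty by definition of \<^const>\<open>connected\<close>.\<close>

definition two_connected_centered_coloring :: "('a, 'b) pre_digraph \<Rightarrow> ('a \<Rightarrow> nat) \<Rightarrow> bool" where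
  "two_connected_centered_coloring G c \<longleftrightarrow>
     (\<forall>H. subgraph H G \<and> graph H \<and> connected H \<and> (\<nexists>v. cutvertex H v)
        \<longrightarrow> (\<exists>k. \<exists>!v. v \<in> verts H \<and> c v = k))"

definition td2 :: "('a, 'b) pre_digraph \<Rightarrow> nat" where
  "td2 G = (LEAST m. \<exists>c. two_connected_centered_coloring G c \<and> card (c ` verts G) = m)"

section \<open>The notions are well defined\<close>

lemma pair_graph_cover_graph:
  assumes "finite P" shows "pair_graph (cover_graph P r)"
proof unfold_locales
  show "finite (parcs (cover_graph P r))"
    by (rule finite_subset[of _ "P \<times> P"]) (auto simp: cover_graph_def covers_def assms)
qed (auto simp: cover_graph_def covers_def symmetric_def assms intro!: symI)

lemma two_connected_centered_coloring_exists:
  fixes G :: "('a, 'b) pre_digraph"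
  assumes "finite (verts G)"
  shows "\<exists>c. two_connected_centered_coloring G c"
proof -
  obtain c :: "'a \<Rightarrow> nat" where inj: "inj_on c (verts G)"
    using finite_imp_inj_to_nat_seg[OF assms] by blast
  have "\<exists>k. \<exists>!v. v \<in> verts H \<and> c v = k" if "subgraph H G" "connected H" for H
  proof -
    from that have "verts H \<subseteq> verts G" "verts H \<noteq> {}"
      by (auto simp: subgraph_def connected_def strongly_connected_def)
    then show ?thesis using inj by (metis (no_types, lifting) all_not_in_conv inj_on_eq_iff subsetD)
  qed
  then show ?thesis unfolding two_connected_centered_coloring_def by blast
qed

lemma partial_order_on_add_pair:
  assumes r: "partial_order_on P r" and ab: "a \<in> P" "b \<in> P" "(b, a) \<notin> r"
  shows "partial_order_on P (r \<union> {(u, v). (u, a) \<in> r \<and> (b, v) \<in> r})"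
proof -
  let ?t = "r \<union> {(u, v). (u, a) \<in> r \<and> (b, v) \<in> r}"
  have rr: "trans r" "antisym r" "refl_on P r" "r \<subseteq> P \<times> P"
    using r by (auto simp: partial_order_on_def preorder_on_def)
  have tr: "(x, z) \<in> r" if "(x, y) \<in> r" "(y, z) \<in> r" for x y z
    using that rr(1) by (rule transD[rotated])
  have no: False if "(b, x) \<in> r" "(x, a) \<in> r" for x
    using tr[OF that] ab(3) by contradiction
  have "trans ?t"
  proof (rule transI)
    fix x y z assume "(x, y) \<in> ?t" "(y, z) \<in> ?t"
    then show "(x, z) \<in> ?t" by (blast intro: tr dest: no)
  qed
  moreover have "antisym ?t"
  proof (rule antisymI)
    fix x y assume "(x, y) \<in> ?t" "(y, x) \<in> ?t"
    then have "(x, y) \<in> r \<and> (y, x) \<in> r" by (blast intro: tr dest: no)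
    then show "x = y" using rr(2) by (blast dest: antisymD)
  qed
  moreover have "refl_on P ?t" using rr(3) by (simp add: refl_on_def)
  moreover have "?t \<subseteq> P \<times> P" using rr(4) by blast
  ultimately show ?thesis by (simp add: partial_order_on_def preorder_on_def)
qed

lemma linear_extension_exists:
  assumes fin: "finite P" and r: "partial_order_on P r"
  shows "\<exists>l. linear_order_on P l \<and> r \<subseteq> l"
proof -
  let ?S = "{s. partial_order_on P s \<and> r \<subseteq> s}"
  have "?S \<subseteq> Pow (P \<times> P)" by (auto simp: partial_order_on_def preorder_on_def)
  then have "finite ?S" using fin by (simp add: finite_subset)
  moreover have "?S \<noteq> {}" using r by auto
  ultimately obtain s where s: "s \<in> ?S" and max: "\<And>t. t \<in> ?S \<Longrightarrow> s \<subseteq> t \<Longrightarrow> s = t"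
    by (metis (no_types, lifting) finite_has_maximal)
  have "total_on P s"
  proof (rule total_onI)
    fix a b assume ab: "a \<in> P" "b \<in> P" "a \<noteq> b"
    show "(a, b) \<in> s \<or> (b, a) \<in> s"
    proof (rule ccontr)
      assume no: "\<not> ?thesis"
      let ?t = "s \<union> {(u, v). (u, a) \<in> s \<and> (b, v) \<in> s}"
      have "?t \<in> ?S" using partial_order_on_add_pair[of P s a b] s ab no by (simp add: le_supI1)
      then have "s = ?t" by (rule max) (rule Un_upper1)
      moreover have "(a, a) \<in> s" "(b, b) \<in> s"
        using s ab by (simp_all add: partial_order_on_def preorder_on_def refl_on_def)
      then have "(a, b) \<in> ?t" by simp
      ultimately show False using no by simp
    qed
  qed
  then show ?thesis using s by (auto simp: linear_order_on_def)
qed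

lemma realizer_exists:
  assumes fin: "finite P" and r: "partial_order_on P r"
  shows "\<exists>L. realizer P r L"
proof -
  let ?L = "{l. linear_order_on P l \<and> r \<subseteq> l}"
  have "?L \<subseteq> Pow (P \<times> P)" by (auto simp: order_on_defs)
  then have "finite ?L" using fin by (simp add: finite_subset)
  moreover have "(x, y) \<in> r" if xy: "x \<in> P" "y \<in> P" and all: "\<forall>l\<in>?L. (x, y) \<in> l" for x y
  proof (rule ccontr)
    assume no: "(x, y) \<notin> r"
    let ?t = "r \<union> {(u, v). (u, y) \<in> r \<and> (x, v) \<in> r}"
    have "partial_order_on P ?t" using partial_order_on_add_pair[OF r xy(2,1) no] .
    then obtain l where l: "linear_order_on P l" "?t \<subseteq> l"
      using linear_extension_exists[OF fin] by blast
    have refl: "(x, x) \<in> r" "(y, y) \<in> r"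
      using r xy by (auto simp: partial_order_on_def preorder_on_def refl_on_def)
    then have "(y, x) \<in> l" using l by auto
    moreover have "(x, y) \<in> l" using all l by auto
    ultimately have "x = y" using l by (auto simp: order_on_defs dest: antisymD)
    with no refl show False by simp
  qed
  ultimately have "realizer P r ?L" unfolding realizer_def by blast
  then show ?thesis by blast
qed

end

theory Submission
  imports Defs
begin

text \<open>
  Let \<open>f m = 2 ^ (m + 1) - 2\<close>, so that \<open>f (m + 1) = 2 * f m + 2\<close>. In an order-convex block \<open>C\<close>
  of the cover graph some vertex \<open>w\<close> has a unique colour. Neither \<open>C\<close> minus the up-set of \<open>w\<close> nor
  \<open>C\<close> minus the down-set of \<open>w\<close> uses that colour, so both have dimension at most \<open>f m\<close> by induction,
  and an incomparable pair of \<open>C\<close> not involving \<open>w\<close> lies in one of them; hence \<open>C\<close> has dimension at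
  most \<open>2 * f m\<close>. The summand 2 comes from the theorem of Trotter, Walczak and Wang that a poset
  whose blocks have dimension at most \<open>d \<ge> 1\<close> has dimension at most \<open>d + 2\<close>.

  For the latter, root the block tree at a vertex \<open>v\<close>. The \<open>d\<close> linear extensions of the blocks are
  merged into linear extensions \<open>M k\<close> of the whole poset in which everything hanging at a vertex is
  inserted tightly around it. A pair \<open>x\<close>, \<open>y\<close> that all \<open>M k\<close> put in the same order \<open>x\<close> before \<open>y\<close>,
  although \<open>x\<close> is not below \<open>y\<close>, is of one of two dual kinds: \<open>x\<close> is not below the vertex at
  which it hangs, or \<open>y\<close> is not above the vertex at which it hangs. One further linear
  extension, which puts the elements not below the root as high as possible, reverses all pairs of
  the first kind, and its dual those of the second kind.
\<close>

section \<open>Linear extensions as injective integer labellings\<close>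

text \<open>With integer labels, restriction to a subset costs nothing, negation gives the dual
  order, and nested orders become lexicographic ones.\<close>

definition linext :: "'a set \<Rightarrow> 'a rel \<Rightarrow> ('a \<Rightarrow> int) \<Rightarrow> bool" where
  "linext X r f \<longleftrightarrow> inj_on f X \<and> (\<forall>x\<in>X. \<forall>y\<in>X. (x, y) \<in> r \<longrightarrow> f x \<le> f y)"

text \<open>The family is indexed and may repeat members, so this is an upper bound on the
  dimension.\<close>

definition dim_le :: "'a set \<Rightarrow> 'a rel \<Rightarrow> nat \<Rightarrow> bool" where
  "dim_le X r d \<longleftrightarrow> (\<exists>L. (\<forall>k<d. linext X r (L k)) \<and>
     (\<forall>x\<in>X. \<forall>y\<in>X. (x, y) \<notin> r \<longrightarrow> (\<exists>k<d. L k y < L k x)))"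

text \<open>Collapses a lexicographic order to a single label, so that orders can be nested
  again.\<close>

definition lex_rank :: "'a set \<Rightarrow> ('a \<Rightarrow> int) \<Rightarrow> ('a \<Rightarrow> int) \<Rightarrow> 'a \<Rightarrow> int" where
  "lex_rank X p q x = int (card {z \<in> X. p z < p x \<or> p z = p x \<and> q z < q x})"

lemma lex_rank_less_iff:
  assumes "finite X" "x \<in> X" "y \<in> X"
  shows "lex_rank X p q x < lex_rank X p q y \<longleftrightarrow> p x < p y \<or> p x = p y \<and> q x < q y"
proof (cases "p x < p y \<or> p x = p y \<and> q x < q y")
  case True
  then have "{z \<in> X. p z < p x \<or> p z = p x \<and> q z < q x} \<subset> {z \<in> X. p z < p y \<or> p z = p y \<and> q z < q y}"
    using assms by auto
  then have "lex_rank X p q x < lex_rank X p q y"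
    unfolding lex_rank_def using assms by (simp add: psubset_card_mono)
  with True show ?thesis by simp
next
  case False
  then have "{z \<in> X. p z < p y \<or> p z = p y \<and> q z < q y} \<subseteq> {z \<in> X. p z < p x \<or> p z = p x \<and> q z < q x}"
    by auto
  then have "lex_rank X p q y \<le> lex_rank X p q x"
    unfolding lex_rank_def using assms by (simp add: card_mono)
  with False show ?thesis by simp
qed

lemma lex_rank_le_iff:
  assumes "finite X" "x \<in> X" "y \<in> X"
  shows "lex_rank X p q x \<le> lex_rank X p q y \<longleftrightarrow> p x < p y \<or> p x = p y \<and> q x \<le> q y"
  using lex_rank_less_iff[OF assms(1,3,2), of p q] by auto

lemma lex_rank_eq_iff:
  assumes "finite X" "x \<in> X" "y \<in> X"
  shows "lex_rank X p q x = lex_rank X p q y \<longleftrightarrow> p x = p y \<and> q x = q y"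
proof -
  have "lex_rank X p q x = lex_rank X p q y \<longleftrightarrow>
      \<not> lex_rank X p q x < lex_rank X p q y \<and> \<not> lex_rank X p q y < lex_rank X p q x"
    by linarith
  also have "\<dots> \<longleftrightarrow> p x = p y \<and> q x = q y"
    unfolding lex_rank_less_iff[OF assms] lex_rank_less_iff[OF assms(1,3,2)] by linarith
  finally show ?thesis .
qed

lemma linext_lex_rank:
  assumes "finite X" "inj_on (\<lambda>x. (p x, q x)) X"
    and "\<And>x y. x \<in> X \<Longrightarrow> y \<in> X \<Longrightarrow> (x, y) \<in> r \<Longrightarrow> p x < p y \<or> p x = p y \<and> q x \<le> q y"
  shows "linext X r (lex_rank X p q)"
  using assms unfolding linext_def inj_on_def
  by (auto simp: lex_rank_le_iff lex_rank_eq_iff)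

lemma linext_uminus: "linext X (r\<inverse>) (\<lambda>x. - f x) \<longleftrightarrow> linext X r f"
  by (auto simp: linext_def inj_on_def)

section \<open>Merging linear extensions at a cutvertex\<close>

text \<open>\<open>N\<close> lists first the elements below \<open>v\<close>, then \<open>v\<close>, then the other elements outside \<open>F\<close>, then
  \<open>F\<close>. When \<open>X\<close> is merged at \<open>v\<close> with another poset, a pair whose first element \<open>x\<close> is not below
  \<open>v\<close> is reversed by some \<open>M k\<close> that puts \<open>x\<close> above \<open>v\<close> if \<open>x\<close> is outside \<open>F\<close>, and by the merged
  \<open>N\<close> otherwise.\<close>

definition one_sided :: "'a rel \<Rightarrow> nat \<Rightarrow> 'a set \<Rightarrow> 'a \<Rightarrow> (nat \<Rightarrow> 'a \<Rightarrow> int) \<Rightarrow> ('a \<Rightarrow> int) \<Rightarrow> bool" where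
  "one_sided r d X v M N \<longleftrightarrow> linext X r N \<and> (\<forall>x\<in>X. (x, v) \<notin> r \<longrightarrow> N v < N x) \<and>
    (\<exists>F \<subseteq> {x \<in> X. (x, v) \<notin> r}.
       (\<forall>x\<in>X - F. (x, v) \<notin> r \<longrightarrow> (\<exists>k<d. M k v < M k x)) \<and>
       (\<forall>x\<in>F. M 0 x < M 0 v) \<and> (\<forall>x\<in>X - F. \<forall>y\<in>F. N x < N y))"

lemma one_sidedE:
  assumes "one_sided r d X v M N"
  obtains F where "linext X r N" "\<And>x. x \<in> X \<Longrightarrow> (x, v) \<notin> r \<Longrightarrow> N v < N x"
    "F \<subseteq> {x \<in> X. (x, v) \<notin> r}"
    "\<And>x. x \<in> X \<Longrightarrow> x \<notin> F \<Longrightarrow> (x, v) \<notin> r \<Longrightarrow> \<exists>k<d. M k v < M k x"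
    "\<And>x. x \<in> F \<Longrightarrow> M 0 x < M 0 v"
    "\<And>x y. x \<in> X \<Longrightarrow> x \<notin> F \<Longrightarrow> y \<in> F \<Longrightarrow> N x < N y"
proof -
  from assms obtain F where F: "F \<subseteq> {x \<in> X. (x, v) \<notin> r}"
    "\<forall>x\<in>X - F. (x, v) \<notin> r \<longrightarrow> (\<exists>k<d. M k v < M k x)"
    "\<forall>x\<in>F. M 0 x < M 0 v" "\<forall>x\<in>X - F. \<forall>y\<in>F. N x < N y"
    unfolding one_sided_def by (elim conjE exE)
  show thesis
    by (rule that[of F]) (use assms F in \<open>unfold one_sided_def, (assumption | blast)+\<close>)
qed

text \<open>By \<open>m3\<close> and \<open>m4\<close>, \<open>M\<close> inserts \<open>X2\<close>
  at the place of \<open>v\<close> in \<open>M1\<close>. Let \<open>x\<close> and \<open>y\<close>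
  come from different sides, with \<open>x\<close> not below \<open>v\<close>. If \<open>x\<close>
  is in \<open>X1 - F1\<close>, some \<open>M k\<close> puts it above \<open>v\<close> and hence
  above \<open>X2\<close>. If \<open>y\<close> is in \<open>F1\<close>, \<open>M 0\<close> puts it
  below \<open>v\<close> and hence below \<open>X2\<close>. Otherwise the levels of \<open>N\<close>
  put \<open>y\<close> before \<open>x\<close>.\<close>

lemma one_sided_merge:
  assumes fin: "finite X1" "finite X2" and d: "0 < d" and int: "X1 \<inter> X2 = {v}"
    and vv: "(v, v) \<in> r"
    and c12: "\<And>x y. x \<in> X1 \<Longrightarrow> y \<in> X2 \<Longrightarrow> (x, y) \<in> r \<Longrightarrow> (x, v) \<in> r \<and> (v, y) \<in> r"
    and c21: "\<And>x y. x \<in> X2 \<Longrightarrow> y \<in> X1 \<Longrightarrow> (x, y) \<in> r \<Longrightarrow> (x, v) \<in> r \<and> (v, y) \<in> r"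
    and h1: "one_sided r d X1 v M1 N1" and h2: "one_sided r d X2 v M2 N2"
    and m1: "\<And>k x y. k < d \<Longrightarrow> x \<in> X1 \<Longrightarrow> y \<in> X1 \<Longrightarrow> M k x < M k y \<longleftrightarrow> M1 k x < M1 k y"
    and m2: "\<And>k x y. k < d \<Longrightarrow> x \<in> X2 \<Longrightarrow> y \<in> X2 \<Longrightarrow> M k x < M k y \<longleftrightarrow> M2 k x < M2 k y"
    and m3: "\<And>k x y. k < d \<Longrightarrow> x \<in> X1 \<Longrightarrow> y \<in> X2 \<Longrightarrow> M1 k x < M1 k v \<Longrightarrow> M k x < M k y"
    and m4: "\<And>k x y. k < d \<Longrightarrow> x \<in> X1 \<Longrightarrow> y \<in> X2 \<Longrightarrow> M1 k v < M1 k x \<Longrightarrow> M k y < M k x"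
  shows "\<exists>N. one_sided r d (X1 \<union> X2) v M N \<and>
    (\<forall>x\<in>X1. \<forall>y\<in>X1. N x < N y \<longleftrightarrow> N1 x < N1 y) \<and>
    (\<forall>x\<in>X2. \<forall>y\<in>X2. N x < N y \<longleftrightarrow> N2 x < N2 y) \<and>
    (\<forall>x y. x \<in> X1 \<and> y \<in> X2 \<or> x \<in> X2 \<and> y \<in> X1 \<longrightarrow> (x, v) \<notin> r \<longrightarrow>
       (\<exists>k<d. M k y < M k x) \<or> N y < N x)"
proof -
  have v: "v \<in> X1" "v \<in> X2" using int by auto
  have X12: "x = v" if "x \<in> X1" "x \<in> X2" for x using that int by auto
  from h1 obtain F1 where N1: "linext X1 r N1" "\<And>x. x \<in> X1 \<Longrightarrow> (x, v) \<notin> r \<Longrightarrow> N1 v < N1 x"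
    and F1: "F1 \<subseteq> {x \<in> X1. (x, v) \<notin> r}"
    and E1: "\<And>x. x \<in> X1 \<Longrightarrow> x \<notin> F1 \<Longrightarrow> (x, v) \<notin> r \<Longrightarrow> \<exists>k<d. M1 k v < M1 k x"
    and F1': "\<And>x. x \<in> F1 \<Longrightarrow> M1 0 x < M1 0 v"
    and EF1: "\<And>x y. x \<in> X1 \<Longrightarrow> x \<notin> F1 \<Longrightarrow> y \<in> F1 \<Longrightarrow> N1 x < N1 y"
    by (rule one_sidedE) blast
  from h2 obtain F2 where N2: "linext X2 r N2" "\<And>x. x \<in> X2 \<Longrightarrow> (x, v) \<notin> r \<Longrightarrow> N2 v < N2 x"
    and F2: "F2 \<subseteq> {x \<in> X2. (x, v) \<notin> r}"
    and E2: "\<And>x. x \<in> X2 \<Longrightarrow> x \<notin> F2 \<Longrightarrow> (x, v) \<notin> r \<Longrightarrow> \<exists>k<d. M2 k v < M2 k x"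
    and F2': "\<And>x. x \<in> F2 \<Longrightarrow> M2 0 x < M2 0 v"
    and EF2: "\<And>x y. x \<in> X2 \<Longrightarrow> x \<notin> F2 \<Longrightarrow> y \<in> F2 \<Longrightarrow> N2 x < N2 y"
    by (rule one_sidedE) blast
  \<comment> \<open>In the merged \<open>M k\<close>, \<open>X2\<close> is inserted tightly around \<open>v\<close>, so \<open>X1\<close> is the outer part; the
      final segments \<open>F1\<close>, \<open>F2\<close> must therefore appear in \<open>N\<close> in reversed order.\<close>
  define p :: "'a \<Rightarrow> int" where "p x = (if x = v then 0
      else if x \<in> X1 then (if (x, v) \<in> r then -2 else if x \<in> F1 then 4 else 1)
      else (if (x, v) \<in> r then -1 else if x \<in> F2 then 3 else 2))" for x
  define q where "q x = (if x \<in> X1 then N1 x else N2 x)" for x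
  define N where "N = lex_rank (X1 \<union> X2) p q"
  have less: "N x < N y \<longleftrightarrow> p x < p y \<or> p x = p y \<and> q x < q y" if "x \<in> X1 \<union> X2" "y \<in> X1 \<union> X2" for x y
    unfolding N_def using that fin by (simp add: lex_rank_less_iff)
  have N1le: "N1 x \<le> N1 y" if "x \<in> X1" "y \<in> X1" "(x, y) \<in> r" for x y
    using N1(1) that by (auto simp: linext_def)
  have N2le: "N2 x \<le> N2 y" if "x \<in> X2" "y \<in> X2" "(x, y) \<in> r" for x y
    using N2(1) that by (auto simp: linext_def)
  have N1inj: "x = y" if "x \<in> X1" "y \<in> X1" "N1 x = N1 y" for x y
    using N1(1) that by (auto simp: linext_def inj_on_def)
  have N2inj: "x = y" if "x \<in> X2" "y \<in> X2" "N2 x = N2 y" for x y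
    using N2(1) that by (auto simp: linext_def inj_on_def)
  have down1: "N1 x < N1 v" if "x \<in> X1" "(x, v) \<in> r" "x \<noteq> v" for x
    using N1le[OF that(1) v(1) that(2)] N1inj[OF that(1) v(1)] that(3) by fastforce
  have down2: "N2 x < N2 v" if "x \<in> X2" "(x, v) \<in> r" "x \<noteq> v" for x
    using N2le[OF that(1) v(2) that(2)] N2inj[OF that(1) v(2)] that(3) by fastforce
  \<comment> \<open>The levels cut \<open>N1\<close> on \<open>X1\<close>, and likewise
    \<open>N2\<close> on \<open>X2\<close>, into consecutive intervals; hence \<open>N\<close>
    restricts to both orders.\<close>
  have p1: "p x \<le> p y" if xy: "x \<in> X1" "y \<in> X1" "N1 x \<le> N1 y" for x y
    using xy down1[of x] down1[of y] N1(2)[of x] N1(2)[of y] EF1[of y x] vv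
    by (cases "x = v"; cases "y = v") (auto simp: p_def)
  have p2: "p x \<le> p y" if xy: "x \<in> X2" "y \<in> X2" "N2 x \<le> N2 y" for x y
  proof -
    have "x \<notin> X1 \<or> x = v" "y \<notin> X1 \<or> y = v" using xy X12 by auto
    then show ?thesis
      using xy down2[of x] down2[of y] N2(2)[of x] N2(2)[of y] EF2[of y x] vv
      by (cases "x = v"; cases "y = v") (auto simp: p_def)
  qed
  have pq1: "N x < N y \<longleftrightarrow> N1 x < N1 y" if "x \<in> X1" "y \<in> X1" for x y
    using p1[OF that] p1[OF that(2,1)] that by (cases "N1 y \<le> N1 x") (auto simp: less q_def)
  have pv: "p v = 0" by (simp add: p_def)
  have p0: "p x \<noteq> 0" if "x \<noteq> v" for x using that by (simp add: p_def)
  have pq2: "N x < N y \<longleftrightarrow> N2 x < N2 y" if "x \<in> X2" "y \<in> X2" for x y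
  \<comment> \<open>\<open>q v\<close> comes from \<open>N1\<close>, so inside \<open>X2\<close> a
    comparison with \<open>v\<close> has to be settled by \<open>p\<close>, which vanishes only at
    \<open>v\<close>.\<close>
  proof (cases "x = v \<or> y = v")
    case True
    show ?thesis
    proof (cases "x = y")
      case False
      then have "p x \<noteq> p y" using True p0[of x] p0[of y] pv by auto
      then show ?thesis using p2[OF that] p2[OF that(2,1)] that
        by (cases "N2 y \<le> N2 x") (auto simp: less)
    qed simp
  next
    case False
    then have "x \<notin> X1" "y \<notin> X1" using that X12 by auto
    then show ?thesis using p2[OF that] p2[OF that(2,1)] that
      by (cases "N2 y \<le> N2 x") (auto simp: less q_def)
  qed
  have le_v: "p x < 0" if "x \<in> X1 \<union> X2" "(x, v) \<in> r" "x \<noteq> v" for x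
    using that by (simp add: p_def)
  have ge_v: "p x > 0" if "x \<in> X1 \<union> X2" "(x, v) \<notin> r" for x
    using that vv by (auto simp: p_def)
  have lin: "linext (X1 \<union> X2) r N"
    unfolding linext_def
  proof (intro conjI inj_onI ballI impI)
    fix x y assume xy: "x \<in> X1 \<union> X2" "y \<in> X1 \<union> X2" "N x = N y"
    then have pq: "p x = p y" "q x = q y" using less[OF xy(1,2)] less[OF xy(2,1)] by auto
    show "x = y"
    proof (cases "x \<in> X1 \<longleftrightarrow> y \<in> X1")
      case True
      then show ?thesis using xy pq N1inj[of x y] N2inj[of x y] by (auto simp: q_def)
    next
      case False
      then show ?thesis using pq(1) by (auto simp: p_def split: if_splits)
    qed
  next
    fix x y assume xy: "x \<in> X1 \<union> X2" "y \<in> X1 \<union> X2" "(x, y) \<in> r"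
    have le1: "N x \<le> N y \<longleftrightarrow> N1 x \<le> N1 y" if "x \<in> X1" "y \<in> X1" for x y
      using pq1[OF that(2,1)] by (simp only: not_less[symmetric])
    have le2: "N x \<le> N y \<longleftrightarrow> N2 x \<le> N2 y" if "x \<in> X2" "y \<in> X2" for x y
      using pq2[OF that(2,1)] by (simp only: not_less[symmetric])
    consider (1) "x \<in> X1" "y \<in> X1" | (2) "x \<in> X2" "y \<in> X2" | (3) "(x, v) \<in> r" "(v, y) \<in> r"
      using xy c12 c21 by blast
    then show "N x \<le> N y"
    proof cases
      case 1
      then show ?thesis using N1le[of x y] xy by (simp add: le1)
    next
      case 2
      then show ?thesis using N2le[of x y] xy by (simp add: le2)
    next
      case 3
      have "N x \<le> N v"
        using le_v[of x] xy 3 less[of x v] v pv by (cases "x = v") auto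
      moreover have "N v \<le> N y"
      proof (cases "(y, v) \<in> r")
        case True
        then show ?thesis using xy v 3 N1le[of v y] N2le[of v y] by (auto simp: le1 le2)
      next
        case False
        then show ?thesis using ge_v[of y] xy v less[of v y] pv by auto
      qed
      ultimately show ?thesis by simp
    qed
  qed
  have cross: "(\<exists>k<d. M k y < M k x) \<or> N y < N x"
    if xy: "x \<in> X1 \<and> y \<in> X2 \<or> x \<in> X2 \<and> y \<in> X1" "(x, v) \<notin> r" for x y
  proof -
    have xv: "x \<noteq> v" using xy(2) vv by auto
    have le: ?thesis if "p y < p x" using less[of y x] that xy by auto
    show ?thesis
    proof (cases "p y \<le> 0")
      case True
      then show ?thesis using ge_v[of x] le xy by auto
    next
      case False
      then have y: "y \<noteq> v" using pv by auto
      with False have y': "(y, v) \<notin> r" using le_v[of y] xy(1) by auto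
      show ?thesis
      proof (cases "x \<in> X1")
        case True
        then have X: "x \<in> X1" "y \<in> X2" "y \<notin> X1" using xy y X12 xv by auto
        show ?thesis
        proof (cases "x \<in> F1")
          case True
          then have "p y < p x" using X y y' xy(2) xv by (simp add: p_def)
          then show ?thesis by (rule le)
        next
          case False
          then show ?thesis using E1[OF X(1)] xy(2) m4[OF _ X(1,2)] by blast
        qed
      next
        case False
        then have X: "x \<in> X2" "y \<in> X1" "x \<notin> X1" using xy y X12 xv by auto
        show ?thesis
        proof (cases "y \<in> F1")
          case True
          then show ?thesis using m3[OF d X(2,1)] F1' d by blast
        next
          case False
          then have "p y < p x" using X y y' xy(2) xv by (simp add: p_def)
          then show ?thesis by (rule le)
        qed
      qed
    qed
  qed
  \<comment> \<open>\<open>F1\<close> and \<open>F2\<close> occupy the two top levels 4 and 3, so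
    their union is a final segment of \<open>N\<close>.\<close>
  have "one_sided r d (X1 \<union> X2) v M N"
    unfolding one_sided_def
  proof (intro conjI exI[of _ "F1 \<union> F2"] ballI impI)
    show "linext (X1 \<union> X2) r N" by (rule lin)
    show "N v < N x" if "x \<in> X1 \<union> X2" "(x, v) \<notin> r" for x
      using ge_v[OF that] that less[of v x] v pv by simp
    show "F1 \<union> F2 \<subseteq> {x \<in> X1 \<union> X2. (x, v) \<notin> r}" using F1 F2 by blast
    show "\<exists>k<d. M k v < M k x" if "x \<in> X1 \<union> X2 - (F1 \<union> F2)" "(x, v) \<notin> r" for x
      using that E1[of x] E2[of x] m1[OF _ v(1), of _ x] m2[OF _ v(2), of _ x] by blast
    show "M 0 x < M 0 v" if "x \<in> F1 \<union> F2" for x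
      using that F1' F2' F1 F2 m1[OF d _ v(1), of x] m2[OF d _ v(2), of x] by blast
    show "N x < N y" if xy: "x \<in> X1 \<union> X2 - (F1 \<union> F2)" "y \<in> F1 \<union> F2" for x y
    proof -
      have "y \<noteq> v" "x \<notin> F1" "x \<notin> F2" "(y, v) \<notin> r" "y \<in> X1 \<union> X2" using xy F1 F2 vv by auto
      moreover have "y \<in> F1 \<longleftrightarrow> y \<in> X1"
        using xy(2) X12[of y] \<open>y \<noteq> v\<close> F1 F2 by blast
      ultimately have "p x < p y" using xy by (auto simp: p_def)
      then show ?thesis using less[of x y] xy \<open>y \<in> X1 \<union> X2\<close> by simp
    qed
  qed
  then show ?thesis using pq1 pq2 cross by blast
qed

text \<open>\<open>N'\<close> is a linear extension of the dual order; its negative is the second extra linear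
  extension.\<close>

definition rooted_by ::
  "'a rel \<Rightarrow> nat \<Rightarrow> 'a set \<Rightarrow> 'a \<Rightarrow> (nat \<Rightarrow> 'a \<Rightarrow> int) \<Rightarrow> ('a \<Rightarrow> int) \<Rightarrow> ('a \<Rightarrow> int) \<Rightarrow> bool" where
  "rooted_by r d X v M N N' \<longleftrightarrow> (\<forall>k<d. linext X r (M k)) \<and> one_sided r d X v M N \<and>
     one_sided (r\<inverse>) d X v (\<lambda>k x. - M k x) N' \<and>
     (\<forall>x\<in>X. \<forall>y\<in>X. (x, y) \<notin> r \<longrightarrow> (\<exists>k<d. M k y < M k x) \<or> N y < N x \<or> N' x < N' y)"

definition rooted :: "'a rel \<Rightarrow> nat \<Rightarrow> 'a set \<Rightarrow> 'a \<Rightarrow> bool" where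
  "rooted r d X v \<longleftrightarrow> (\<exists>M N N'. rooted_by r d X v M N N')"

text \<open>The two labellings after the \<open>M k\<close> are \<open>N\<close> and the negative of
  \<open>N'\<close>.\<close>

lemma rooted_dim_le:
  assumes "rooted r d X v"
  shows "dim_le X r (d + 2)"
proof -
  from assms obtain M N N' where M: "\<And>k. k < d \<Longrightarrow> linext X r (M k)"
    and N: "one_sided r d X v M N" and N': "one_sided (r\<inverse>) d X v (\<lambda>k x. - M k x) N'"
    and rev: "\<And>x y. x \<in> X \<Longrightarrow> y \<in> X \<Longrightarrow> (x, y) \<notin> r \<Longrightarrow>
      (\<exists>k<d. M k y < M k x) \<or> N y < N x \<or> N' x < N' y"
    unfolding rooted_def rooted_by_def by blast
  define L where "L k = (if k < d then M k else if k = d then N else (\<lambda>x. - N' x))" for k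
  have "linext X r N" "linext X r (\<lambda>x. - N' x)"
    using N N' linext_uminus[of X r "\<lambda>x. - N' x"] by (auto simp: one_sided_def)
  then have "linext X r (L k)" for k by (auto simp: L_def M)
  moreover have "\<exists>k<d + 2. L k y < L k x" if xy: "x \<in> X" "y \<in> X" "(x, y) \<notin> r" for x y
    using rev[OF xy]
  proof (elim disjE exE conjE)
    fix k assume "k < d" "M k y < M k x"
    then show ?thesis by (intro exI[of _ k]) (simp add: L_def)
  next
    assume "N y < N x"
    then show ?thesis by (intro exI[of _ d]) (simp add: L_def)
  next
    assume "N' x < N' y"
    then show ?thesis by (intro exI[of _ "d + 1"]) (simp add: L_def)
  qed
  ultimately show ?thesis unfolding dim_le_def by blast
qed

text \<open>The case of an empty final segment \<open>F\<close>.\<close>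

lemma one_sidedI:
  assumes "linext X r N" "\<And>x. x \<in> X \<Longrightarrow> (x, v) \<notin> r \<Longrightarrow> N v < N x"
    and "\<And>x. x \<in> X \<Longrightarrow> (x, v) \<notin> r \<Longrightarrow> \<exists>k<d. M k v < M k x"
  shows "one_sided r d X v M N"
  unfolding one_sided_def using assms by (intro conjI exI[of _ "{}"]) auto

lemma rooted_singleton:
  assumes "(v, v) \<in> r"
  shows "rooted r d {v} v"
  unfolding rooted_def rooted_by_def
  using assms
  by (intro exI[of _ "\<lambda>_ _. 0"] exI[of _ "\<lambda>_. 0"]) (auto simp: linext_def intro!: one_sidedI)

text \<open>If \<open>x\<close> is not below \<open>y\<close> and they lie on different sides, then
  by transitivity \<open>x\<close> is not below \<open>v\<close> or \<open>y\<close> is not above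
  \<open>v\<close>. \<open>one_sided_merge\<close> handles the first kind through \<open>N\<close>
  and, applied to the dual order, the second kind through \<open>N'\<close>.\<close>

lemma rooted_merge:
  assumes fin: "finite X1" "finite X2" and d: "0 < d" and int: "X1 \<inter> X2 = {v}"
    and tr: "trans r" and vv: "(v, v) \<in> r"
    and c12: "\<And>x y. x \<in> X1 \<Longrightarrow> y \<in> X2 \<Longrightarrow> (x, y) \<in> r \<Longrightarrow> (x, v) \<in> r \<and> (v, y) \<in> r"
    and c21: "\<And>x y. x \<in> X2 \<Longrightarrow> y \<in> X1 \<Longrightarrow> (x, y) \<in> r \<Longrightarrow> (x, v) \<in> r \<and> (v, y) \<in> r"
    and r1: "rooted r d X1 v" and r2: "rooted r d X2 v"
  shows "rooted r d (X1 \<union> X2) v"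
proof -
  have v: "v \<in> X1" "v \<in> X2" using int by auto
  have X12: "x \<notin> X2 \<or> x = v" if "x \<in> X1" for x using that int by auto
  from r1 obtain M1 N1 N1' where M1: "\<And>k. k < d \<Longrightarrow> linext X1 r (M1 k)"
    and N1: "one_sided r d X1 v M1 N1" and N1': "one_sided (r\<inverse>) d X1 v (\<lambda>k x. - M1 k x) N1'"
    and rev1: "\<And>x y. x \<in> X1 \<Longrightarrow> y \<in> X1 \<Longrightarrow> (x, y) \<notin> r \<Longrightarrow>
      (\<exists>k<d. M1 k y < M1 k x) \<or> N1 y < N1 x \<or> N1' x < N1' y"
    unfolding rooted_def rooted_by_def by blast
  from r2 obtain M2 N2 N2' where M2: "\<And>k. k < d \<Longrightarrow> linext X2 r (M2 k)"
    and N2: "one_sided r d X2 v M2 N2" and N2': "one_sided (r\<inverse>) d X2 v (\<lambda>k x. - M2 k x) N2'"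
    and rev2: "\<And>x y. x \<in> X2 \<Longrightarrow> y \<in> X2 \<Longrightarrow> (x, y) \<notin> r \<Longrightarrow>
      (\<exists>k<d. M2 k y < M2 k x) \<or> N2 y < N2 x \<or> N2' x < N2' y"
    unfolding rooted_def rooted_by_def by blast
  \<comment> \<open>All of \<open>X2\<close> shares the level 0 of \<open>v\<close>, the elements of
    \<open>X1\<close> before and after \<open>v\<close> get levels -1 and 1, and \<open>q\<close>
    orders each level by the given labelling.\<close>
  define p where "p k x = (if x \<in> X2 then 0 else sgn (M1 k x - M1 k v))" for k x
  define q where "q k x = (if x \<in> X2 then M2 k x else M1 k x)" for k x
  define M where "M k = lex_rank (X1 \<union> X2) (p k) (q k)" for k
  have less: "M k x < M k y \<longleftrightarrow> p k x < p k y \<or> p k x = p k y \<and> q k x < q k y"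
    if "x \<in> X1 \<union> X2" "y \<in> X1 \<union> X2" for k x y
    unfolding M_def using that fin by (simp add: lex_rank_less_iff)
  have neq: "M1 k x \<noteq> M1 k v" if "k < d" "x \<in> X1" "x \<noteq> v" for k x
    using M1[OF that(1)] that(2,3) v by (auto simp: linext_def inj_on_def)
  have m1: "M k x < M k y \<longleftrightarrow> M1 k x < M1 k y" if k: "k < d" and xy: "x \<in> X1" "y \<in> X1" for k x y
  proof (cases "x = v \<or> y = v")
    case True
    then show ?thesis
      using xy v X12[of x] X12[of y] neq[OF k, of x] neq[OF k, of y]
      by (cases "x = y"; cases "x = v") (auto simp: less p_def sgn_if split: if_splits)
  next
    case False
    then have "x \<notin> X2" "y \<notin> X2" using xy X12 by auto
    then show ?thesis using xy False neq[OF k, of x] neq[OF k, of y]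
      by (auto simp: less p_def q_def sgn_if)
  qed
  have m2: "M k x < M k y \<longleftrightarrow> M2 k x < M2 k y" if "x \<in> X2" "y \<in> X2" for k x y
    using that by (simp add: less p_def q_def)
  have m3: "M k x < M k y" if "x \<in> X1" "y \<in> X2" "M1 k x < M1 k v" for k x y
    using that X12[of x] by (auto simp: less p_def)
  have m4: "M k y < M k x" if "x \<in> X1" "y \<in> X2" "M1 k v < M1 k x" for k x y
    using that X12[of x] by (auto simp: less p_def)
  have le1: "M k x \<le> M k y \<longleftrightarrow> M1 k x \<le> M1 k y" if "k < d" "x \<in> X1" "y \<in> X1" for k x y
    using m1[OF that(1,3,2)] by (simp only: not_less[symmetric])
  have le2: "M k x \<le> M k y \<longleftrightarrow> M2 k x \<le> M2 k y" if "x \<in> X2" "y \<in> X2" for k x y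
    using m2[OF that(2,1)] by (simp only: not_less[symmetric])
  have lin: "linext (X1 \<union> X2) r (M k)" if k: "k < d" for k
    unfolding linext_def
  proof (intro conjI inj_onI ballI impI)
    fix x y assume xy: "x \<in> X1 \<union> X2" "y \<in> X1 \<union> X2" "M k x = M k y"
    have e1: "x = y" if "x \<in> X1" "y \<in> X1"
      using that xy(3) le1[OF k that] le1[OF k that(2,1)] M1[OF k]
      by (auto simp: linext_def inj_on_def)
    have e2: "x = y" if "x \<in> X2" "y \<in> X2"
      using that xy(3) le2[OF that, of k] le2[OF that(2,1), of k] M2[OF k]
      by (auto simp: linext_def inj_on_def)
    have "False" if "a \<in> X1" "a \<notin> X2" "b \<in> X2" "M k a = M k b" for a b
      using neq[OF k that(1)] m3[OF that(1,3), of k] m4[OF that(1,3), of k] v that by force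
    then show "x = y" using e1 e2 xy by (metis UnE)
  next
    fix x y assume xy: "x \<in> X1 \<union> X2" "y \<in> X1 \<union> X2" "(x, y) \<in> r"
    have l1: "M k x \<le> M k y" if "x \<in> X1" "y \<in> X1" "(x, y) \<in> r" for x y
      using that le1[OF k] M1[OF k] by (auto simp: linext_def)
    have l2: "M k x \<le> M k y" if "x \<in> X2" "y \<in> X2" "(x, y) \<in> r" for x y
      using that le2 M2[OF k] by (auto simp: linext_def)
    have l3: "M k x \<le> M k y" if "(x, v) \<in> r" "(v, y) \<in> r"
      using xy l1[of x v] l1[of v y] l2[of x v] l2[of v y] that v by fastforce
    show "M k x \<le> M k y"
      using l1[OF _ _ xy(3)] l2[OF _ _ xy(3)] l3 xy c12 c21 by blast
  qed
  obtain N where N: "one_sided r d (X1 \<union> X2) v M N"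
    and Na: "\<And>x y. x \<in> X1 \<Longrightarrow> y \<in> X1 \<Longrightarrow> N x < N y \<longleftrightarrow> N1 x < N1 y"
      "\<And>x y. x \<in> X2 \<Longrightarrow> y \<in> X2 \<Longrightarrow> N x < N y \<longleftrightarrow> N2 x < N2 y"
    and Nc: "\<And>x y. x \<in> X1 \<and> y \<in> X2 \<or> x \<in> X2 \<and> y \<in> X1 \<Longrightarrow> (x, v) \<notin> r \<Longrightarrow>
       (\<exists>k<d. M k y < M k x) \<or> N y < N x"
  proof -
    have "\<exists>N. one_sided r d (X1 \<union> X2) v M N \<and>
      (\<forall>x\<in>X1. \<forall>y\<in>X1. N x < N y \<longleftrightarrow> N1 x < N1 y) \<and>
      (\<forall>x\<in>X2. \<forall>y\<in>X2. N x < N y \<longleftrightarrow> N2 x < N2 y) \<and>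
      (\<forall>x y. x \<in> X1 \<and> y \<in> X2 \<or> x \<in> X2 \<and> y \<in> X1 \<longrightarrow> (x, v) \<notin> r \<longrightarrow>
         (\<exists>k<d. M k y < M k x) \<or> N y < N x)"
      by (rule one_sided_merge[OF fin d int vv c12 c21 N1 N2 m1 m2 m3 m4]; assumption)
    then show ?thesis by (elim exE conjE) (rule that, (assumption | blast)+)
  qed
  \<comment> \<open>The dual order goes with the negated \<open>M k\<close>, which exchanges
    \<open>m3\<close> with \<open>m4\<close> and \<open>c12\<close> with \<open>c21\<close>.\<close>
  obtain N' where N': "one_sided (r\<inverse>) d (X1 \<union> X2) v (\<lambda>k x. - M k x) N'"
    and Na': "\<And>x y. x \<in> X1 \<Longrightarrow> y \<in> X1 \<Longrightarrow> N' x < N' y \<longleftrightarrow> N1' x < N1' y"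
      "\<And>x y. x \<in> X2 \<Longrightarrow> y \<in> X2 \<Longrightarrow> N' x < N' y \<longleftrightarrow> N2' x < N2' y"
    and Nc': "\<And>x y. x \<in> X1 \<and> y \<in> X2 \<or> x \<in> X2 \<and> y \<in> X1 \<Longrightarrow> (v, x) \<notin> r \<Longrightarrow>
       (\<exists>k<d. - M k y < - M k x) \<or> N' y < N' x"
  proof -
    have "\<exists>N. one_sided (r\<inverse>) d (X1 \<union> X2) v (\<lambda>k x. - M k x) N \<and>
      (\<forall>x\<in>X1. \<forall>y\<in>X1. N x < N y \<longleftrightarrow> N1' x < N1' y) \<and>
      (\<forall>x\<in>X2. \<forall>y\<in>X2. N x < N y \<longleftrightarrow> N2' x < N2' y) \<and>
      (\<forall>x y. x \<in> X1 \<and> y \<in> X2 \<or> x \<in> X2 \<and> y \<in> X1 \<longrightarrow> (x, v) \<notin> r\<inverse> \<longrightarrow>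
         (\<exists>k<d. - M k y < - M k x) \<or> N y < N x)"
    proof (rule one_sided_merge[OF fin d int _ _ _ N1' N2'])
      show "(v, v) \<in> r\<inverse>" using vv by simp
      show "(x, v) \<in> r\<inverse> \<and> (v, y) \<in> r\<inverse>" if "x \<in> X1" "y \<in> X2" "(x, y) \<in> r\<inverse>" for x y
        using c21[of y x] that by simp
      show "(x, v) \<in> r\<inverse> \<and> (v, y) \<in> r\<inverse>" if "x \<in> X2" "y \<in> X1" "(x, y) \<in> r\<inverse>" for x y
        using c12[of y x] that by simp
    qed (simp_all add: m1 m2 m3 m4)
    then show ?thesis by (elim exE conjE) (rule that, (assumption | blast)+)
  qed
  have "(\<exists>k<d. M k y < M k x) \<or> N y < N x \<or> N' x < N' y"
    if xy: "x \<in> X1 \<union> X2" "y \<in> X1 \<union> X2" "(x, y) \<notin> r" for x y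
  proof -
    consider (1) "x \<in> X1" "y \<in> X1" | (2) "x \<in> X2" "y \<in> X2"
      | (3) "x \<in> X1 \<and> y \<in> X2 \<or> x \<in> X2 \<and> y \<in> X1"
      using xy by blast
    then show ?thesis
    proof cases
      case 1
      then show ?thesis using rev1[OF 1 xy(3)] m1 Na(1) Na'(1) by blast
    next
      case 2
      then show ?thesis using rev2[OF 2 xy(3)] m2 Na(2) Na'(2) by blast
    next
      case 3
      have "(x, v) \<notin> r \<or> (v, y) \<notin> r" using xy(3) tr by (blast dest: transD)
      then show ?thesis
      proof
        assume "(x, v) \<notin> r" then show ?thesis using Nc[OF 3] by blast
      next
        assume "(v, y) \<notin> r"
        then have "(\<exists>k<d. - M k x < - M k y) \<or> N' x < N' y" using 3 by (intro Nc') auto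
        then show ?thesis by auto
      qed
    qed
  qed
  then show ?thesis unfolding rooted_def rooted_by_def using lin N N' by blast
qed

section \<open>Substituting rooted posets into a block\<close>

text \<open>Here \<open>\<gamma> x\<close> is the vertex of the block \<open>C\<close> at which
  \<open>x\<close> hangs, and \<open>M k\<close> replaces each vertex in \<open>L k\<close> by what
  hangs there. \<open>N\<close> has to reverse the pairs that \<open>L 0\<close> leaves in order and
  whose first element is not below its own vertex.\<close>

lemma one_sided_block:
  assumes fin: "finite X" and gX: "\<And>x. x \<in> X \<Longrightarrow> \<gamma> x \<in> C" and CX: "C \<subseteq> X"
    and gC: "\<And>g. g \<in> C \<Longrightarrow> \<gamma> g = g" and v: "v \<in> C" and gv: "\<And>x. x \<in> X \<Longrightarrow> \<gamma> x = v \<Longrightarrow> x = v"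
    and refl: "\<And>x. x \<in> X \<Longrightarrow> (x, x) \<in> r" and tr: "trans r" and d: "0 < d"
    and cross: "\<And>x y. x \<in> X \<Longrightarrow> y \<in> X \<Longrightarrow> \<gamma> x \<noteq> \<gamma> y \<Longrightarrow> (x, y) \<in> r \<Longrightarrow>
      (x, \<gamma> x) \<in> r \<and> (\<gamma> x, \<gamma> y) \<in> r \<and> (\<gamma> y, y) \<in> r"
    and L: "\<And>k. k < d \<Longrightarrow> linext C r (L k)"
    and Lrev: "\<And>x y. x \<in> C \<Longrightarrow> y \<in> C \<Longrightarrow> (x, y) \<notin> r \<Longrightarrow> \<exists>k<d. L k y < L k x"
    and h: "\<And>g. g \<in> C \<Longrightarrow> one_sided r d {x \<in> X. \<gamma> x = g} g (MM g) (NN g)"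
    and M: "\<And>k x y. k < d \<Longrightarrow> x \<in> X \<Longrightarrow> y \<in> X \<Longrightarrow>
      M k x < M k y \<longleftrightarrow> L k (\<gamma> x) < L k (\<gamma> y) \<or> \<gamma> x = \<gamma> y \<and> MM (\<gamma> x) k x < MM (\<gamma> x) k y"
  shows "\<exists>N. one_sided r d X v M N \<and>
    (\<forall>x\<in>X. \<forall>y\<in>X. \<gamma> x = \<gamma> y \<longrightarrow> (N x < N y \<longleftrightarrow> NN (\<gamma> x) x < NN (\<gamma> x) y)) \<and>
    (\<forall>x\<in>X. \<forall>y\<in>X. (x, \<gamma> x) \<notin> r \<longrightarrow> L 0 (\<gamma> x) < L 0 (\<gamma> y) \<longrightarrow> N y < N x)"
proof -
  \<comment> \<open>Level 2 holds the elements not below their own vertex and is sorted by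
    decreasing \<open>L 0\<close>, so \<open>x\<close> in it passes every \<open>y\<close> whose
    vertex comes later in \<open>L 0\<close>. This respects \<open>r\<close>: by
    \<open>cross\<close>, an element of level 2 is below nothing that hangs elsewhere.\<close>
  define a :: "'a \<Rightarrow> int" where
    "a x = (if (x, \<gamma> x) \<in> r then (if (\<gamma> x, v) \<in> r then 0 else 1) else 2)" for x
  define b where "b x = (if (x, \<gamma> x) \<in> r then L 0 (\<gamma> x) else - L 0 (\<gamma> x))" for x
  define N where "N = lex_rank X (lex_rank X a b) (\<lambda>x. NN (\<gamma> x) x)"
  have less: "N x < N y \<longleftrightarrow> a x < a y \<or> a x = a y \<and> (b x < b y \<or> b x = b y \<and> NN (\<gamma> x) x < NN (\<gamma> y) y)"
    if "x \<in> X" "y \<in> X" for x y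
    unfolding N_def using that fin by (auto simp: lex_rank_less_iff lex_rank_eq_iff)
  have le: "N x \<le> N y \<longleftrightarrow> a x < a y \<or> a x = a y \<and> (b x < b y \<or> b x = b y \<and> NN (\<gamma> x) x \<le> NN (\<gamma> y) y)"
    if "x \<in> X" "y \<in> X" for x y
    unfolding N_def using that fin by (auto simp: lex_rank_less_iff lex_rank_le_iff lex_rank_eq_iff)
  have Linj: "g = h" if "g \<in> C" "h \<in> C" "L 0 g = L 0 h" for g h
    using L[OF d] that by (auto simp: linext_def inj_on_def)
  have Lle: "L 0 g < L 0 h" if "g \<in> C" "h \<in> C" "(g, h) \<in> r" "g \<noteq> h" for g h
    using L[OF d] that Linj[of g h] by (auto simp: linext_def order_less_le)
  have NNinj: "x = y" if "x \<in> X" "y \<in> X" "\<gamma> x = \<gamma> y" "NN (\<gamma> x) x = NN (\<gamma> y) y" for x y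
    using h[OF gX[OF that(1)]] that by (auto simp: one_sided_def linext_def inj_on_def)
  have NNle: "NN (\<gamma> x) x \<le> NN (\<gamma> y) y" if "x \<in> X" "y \<in> X" "\<gamma> x = \<gamma> y" "(x, y) \<in> r" for x y
    using h[OF gX[OF that(1)]] that by (auto simp: one_sided_def linext_def)
  have NNup: "NN (\<gamma> x) (\<gamma> x) < NN (\<gamma> x) x" if "x \<in> X" "(x, \<gamma> x) \<notin> r" for x
    using h[OF gX[OF that(1)]] that by (auto simp: one_sided_def)
  have NNdn: "NN (\<gamma> x) x \<le> NN (\<gamma> x) (\<gamma> x)" if "x \<in> X" "(x, \<gamma> x) \<in> r" for x
    using NNle[of x "\<gamma> x"] that gX CX gC by auto
  \<comment> \<open>Among the elements hanging at one vertex the level changes only between those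
    below that vertex and the others, and \<open>NN\<close> lists the former first.\<close>
  have same: "N x < N y \<longleftrightarrow> NN (\<gamma> x) x < NN (\<gamma> x) y" if "x \<in> X" "y \<in> X" "\<gamma> x = \<gamma> y" for x y
    using that NNup[of x] NNup[of y] NNdn[of x] NNdn[of y]
    by (cases "(x, \<gamma> x) \<in> r"; cases "(y, \<gamma> y) \<in> r") (auto simp: less a_def b_def)
  have lin: "linext X r N"
    unfolding linext_def
  proof (intro conjI inj_onI ballI impI)
    fix x y assume xy: "x \<in> X" "y \<in> X" "N x = N y"
    then have e: "a x = a y" "b x = b y" "NN (\<gamma> x) x = NN (\<gamma> y) y"
      using le[of x y] le[of y x] by auto
    then have "L 0 (\<gamma> x) = L 0 (\<gamma> y)" by (auto simp: a_def b_def split: if_splits)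
    then have "\<gamma> x = \<gamma> y" using Linj gX xy by blast
    then show "x = y" using NNinj xy e by blast
  next
    fix x y assume xy: "x \<in> X" "y \<in> X" "(x, y) \<in> r"
    show "N x \<le> N y"
    proof (cases "\<gamma> x = \<gamma> y")
      case True
      then show ?thesis using same[of y x] NNle[of x y] xy by (simp add: not_less[symmetric])
    next
      case False
      note c = cross[OF xy(1,2) False xy(3)]
      have "(\<gamma> x, v) \<in> r" if "(\<gamma> y, v) \<in> r" using c that tr by (blast dest: transD)
      moreover have "L 0 (\<gamma> x) < L 0 (\<gamma> y)" using c False gX xy by (intro Lle) auto
      ultimately show ?thesis using c xy by (auto simp: le a_def b_def)
    qed
  qed
  have av: "a v = 0" "b v = L 0 v" "v \<in> X" using v gC CX refl by (auto simp: a_def b_def)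
  have notdn: "\<gamma> x \<noteq> v" if "x \<in> X" "(x, v) \<notin> r" for x
    using gv[OF that(1)] that refl by auto
  have notin: "\<not> ((x, \<gamma> x) \<in> r \<and> (\<gamma> x, v) \<in> r)" if "(x, v) \<notin> r" for x
    using that tr by (blast dest: transD)
  \<comment> \<open>By the decreasing order on level 2 these elements come last in
    \<open>N\<close>.\<close>
  define F where "F = {x \<in> X. (x, \<gamma> x) \<notin> r \<and> L 0 (\<gamma> x) < L 0 v}"
  have xv: "(x, v) \<notin> r" if "x \<in> X" "(x, \<gamma> x) \<notin> r" for x
  proof
    assume r: "(x, v) \<in> r"
    show False
    proof (cases "\<gamma> x = v")
      case True
      then show False using that r by auto
    next
      case False
      then show False using cross[OF that(1) av(3) _ r] gC v that by auto
    qed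
  qed
  have "one_sided r d X v M N"
    unfolding one_sided_def
  proof (intro conjI exI[of _ F] ballI impI)
    show "linext X r N" by (rule lin)
    show "N v < N x" if "x \<in> X" "(x, v) \<notin> r" for x
      using that notin[OF that(2)] av less[of v x] by (auto simp: a_def)
    show "F \<subseteq> {x \<in> X. (x, v) \<notin> r}" using xv by (auto simp: F_def)
    show "\<exists>k<d. M k v < M k x" if "x \<in> X - F" "(x, v) \<notin> r" for x
    proof -
      have x: "x \<in> X" and g: "\<gamma> x \<noteq> v" "\<gamma> x \<in> C" using that notdn gX by auto
      \<comment> \<open>Outside \<open>F\<close>, either \<open>\<gamma> x\<close> is not below
        \<open>v\<close> and \<open>Lrev\<close> applies, or \<open>x\<close> is on level 2 and
        \<open>L 0\<close> itself puts \<open>\<gamma> x\<close> after \<open>v\<close>.\<close>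
      have "\<exists>k<d. L k v < L k (\<gamma> x)"
      proof (cases "(x, \<gamma> x) \<in> r")
        case True
        then show ?thesis using Lrev[OF g(2) v] notin[OF that(2)] by blast
      next
        case False
        then have "L 0 v < L 0 (\<gamma> x)" using that g Linj[OF g(2) v] by (force simp: F_def)
        then show ?thesis using d by blast
      qed
      then show ?thesis using M[OF _ av(3) x] gC[OF v] by auto
    qed
    show "M 0 x < M 0 v" if "x \<in> F" for x
      using that M[OF d _ av(3)] gC[OF v] by (auto simp: F_def)
    show "N x < N y" if "x \<in> X - F" "y \<in> F" for x y
      using that by (auto simp: F_def less a_def b_def)
  qed
  moreover have "N y < N x" if "x \<in> X" "y \<in> X" "(x, \<gamma> x) \<notin> r" "L 0 (\<gamma> x) < L 0 (\<gamma> y)" for x y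
    using that by (auto simp: less a_def b_def)
  ultimately show ?thesis using same by blast
qed

text \<open>Let \<open>x\<close> and \<open>y\<close> hang at different vertices, with
  \<open>x\<close> not below \<open>y\<close> and \<open>L 0\<close> keeping their order. One link
  of the chain \<open>x\<close>, \<open>\<gamma> x\<close>, \<open>\<gamma> y\<close>,
  \<open>y\<close> must fail: the first is repaired by \<open>N\<close>, the middle one by some
  \<open>L k\<close>, the last one by \<open>N'\<close>.\<close>

lemma rooted_block:
  assumes fin: "finite X" and gX: "\<And>x. x \<in> X \<Longrightarrow> \<gamma> x \<in> C" and CX: "C \<subseteq> X"
    and gC: "\<And>g. g \<in> C \<Longrightarrow> \<gamma> g = g" and v: "v \<in> C" and gv: "\<And>x. x \<in> X \<Longrightarrow> \<gamma> x = v \<Longrightarrow> x = v"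
    and refl: "\<And>x. x \<in> X \<Longrightarrow> (x, x) \<in> r" and tr: "trans r" and d: "0 < d"
    and cross: "\<And>x y. x \<in> X \<Longrightarrow> y \<in> X \<Longrightarrow> \<gamma> x \<noteq> \<gamma> y \<Longrightarrow> (x, y) \<in> r \<Longrightarrow>
      (x, \<gamma> x) \<in> r \<and> (\<gamma> x, \<gamma> y) \<in> r \<and> (\<gamma> y, y) \<in> r"
    and dim: "dim_le C r d"
    and rt: "\<And>g. g \<in> C \<Longrightarrow> rooted r d {x \<in> X. \<gamma> x = g} g"
  shows "rooted r d X v"
proof -
  from dim obtain L where L: "\<And>k. k < d \<Longrightarrow> linext C r (L k)"
    and Lrev: "\<And>x y. x \<in> C \<Longrightarrow> y \<in> C \<Longrightarrow> (x, y) \<notin> r \<Longrightarrow> \<exists>k<d. L k y < L k x"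
    unfolding dim_le_def by blast
  from rt have "\<forall>g\<in>C. \<exists>M N N'. rooted_by r d {x \<in> X. \<gamma> x = g} g M N N'"
    unfolding rooted_def by blast
  then obtain MM NN NN' where
    all: "\<And>g. g \<in> C \<Longrightarrow> rooted_by r d {x \<in> X. \<gamma> x = g} g (MM g) (NN g) (NN' g)"
    by metis
  have MMlin: "linext {x \<in> X. \<gamma> x = g} r (MM g k)" if "g \<in> C" "k < d" for g k
    using all[OF that(1)] that(2) by (simp add: rooted_by_def)
  have h: "one_sided r d {x \<in> X. \<gamma> x = g} g (MM g) (NN g)" if "g \<in> C" for g
    using all[OF that] by (simp add: rooted_by_def)
  have h': "one_sided (r\<inverse>) d {x \<in> X. \<gamma> x = g} g (\<lambda>k x. - MM g k x) (NN' g)" if "g \<in> C" for g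
    using all[OF that] by (simp add: rooted_by_def)
  have rev: "(\<exists>k<d. MM (\<gamma> x) k y < MM (\<gamma> x) k x) \<or> NN (\<gamma> x) y < NN (\<gamma> x) x \<or> NN' (\<gamma> x) x < NN' (\<gamma> x) y"
    if "x \<in> X" "y \<in> X" "\<gamma> x = \<gamma> y" "(x, y) \<notin> r" for x y
    using all[OF gX[OF that(1)]] that by (simp add: rooted_by_def)
  define M where "M k = lex_rank X (\<lambda>x. L k (\<gamma> x)) (\<lambda>x. MM (\<gamma> x) k x)" for k
  have Linj: "L k (\<gamma> x) = L k (\<gamma> y) \<longleftrightarrow> \<gamma> x = \<gamma> y" if "k < d" "x \<in> X" "y \<in> X" for k x y
    using L[OF that(1)] gX that by (auto simp: linext_def inj_on_def)
  have M: "M k x < M k y \<longleftrightarrow> L k (\<gamma> x) < L k (\<gamma> y) \<or> \<gamma> x = \<gamma> y \<and> MM (\<gamma> x) k x < MM (\<gamma> x) k y"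
    if "k < d" "x \<in> X" "y \<in> X" for k x y
    unfolding M_def using that fin Linj[OF that] by (auto simp: lex_rank_less_iff)
  have Mlin: "linext X r (M k)" if k: "k < d" for k
    unfolding M_def
  proof (rule linext_lex_rank[OF fin])
    show "inj_on (\<lambda>x. (L k (\<gamma> x), MM (\<gamma> x) k x)) X"
    proof (rule inj_onI)
      fix x y assume xy: "x \<in> X" "y \<in> X" "(L k (\<gamma> x), MM (\<gamma> x) k x) = (L k (\<gamma> y), MM (\<gamma> y) k y)"
      then have "\<gamma> x = \<gamma> y" using Linj[OF k] by auto
      then show "x = y" using xy MMlin[OF gX k, of x] by (auto simp: linext_def inj_on_def)
    qed
    fix x y assume xy: "x \<in> X" "y \<in> X" "(x, y) \<in> r"
    show "L k (\<gamma> x) < L k (\<gamma> y) \<or> L k (\<gamma> x) = L k (\<gamma> y) \<and> MM (\<gamma> x) k x \<le> MM (\<gamma> y) k y"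
    proof (cases "\<gamma> x = \<gamma> y")
      case True
      then show ?thesis using xy MMlin[OF gX k, of x] by (auto simp: linext_def)
    next
      case False
      then have "L k (\<gamma> x) \<le> L k (\<gamma> y)"
        using cross[OF xy(1,2) False xy(3)] L[OF k] gX xy by (auto simp: linext_def)
      then show ?thesis using Linj[OF k xy(1,2)] False by auto
    qed
  qed
  obtain N where N: "one_sided r d X v M N"
    and Na: "\<And>x y. x \<in> X \<Longrightarrow> y \<in> X \<Longrightarrow> \<gamma> x = \<gamma> y \<Longrightarrow> N x < N y \<longleftrightarrow> NN (\<gamma> x) x < NN (\<gamma> x) y"
    and Nc: "\<And>x y. x \<in> X \<Longrightarrow> y \<in> X \<Longrightarrow> (x, \<gamma> x) \<notin> r \<Longrightarrow> L 0 (\<gamma> x) < L 0 (\<gamma> y) \<Longrightarrow> N y < N x"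
  proof -
    have "\<exists>N. one_sided r d X v M N \<and>
      (\<forall>x\<in>X. \<forall>y\<in>X. \<gamma> x = \<gamma> y \<longrightarrow> (N x < N y \<longleftrightarrow> NN (\<gamma> x) x < NN (\<gamma> x) y)) \<and>
      (\<forall>x\<in>X. \<forall>y\<in>X. (x, \<gamma> x) \<notin> r \<longrightarrow> L 0 (\<gamma> x) < L 0 (\<gamma> y) \<longrightarrow> N y < N x)"
      by (rule one_sided_block[OF fin gX CX gC v gv refl tr d cross L Lrev h M]; assumption)
    then show ?thesis using that by auto
  qed
  obtain N' where N': "one_sided (r\<inverse>) d X v (\<lambda>k x. - M k x) N'"
    and Na': "\<And>x y. x \<in> X \<Longrightarrow> y \<in> X \<Longrightarrow> \<gamma> x = \<gamma> y \<Longrightarrow> N' x < N' y \<longleftrightarrow> NN' (\<gamma> x) x < NN' (\<gamma> x) y"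
    and Nc': "\<And>x y. x \<in> X \<Longrightarrow> y \<in> X \<Longrightarrow> (\<gamma> x, x) \<notin> r \<Longrightarrow> - L 0 (\<gamma> x) < - L 0 (\<gamma> y) \<Longrightarrow> N' y < N' x"
  proof -
    have "\<exists>N. one_sided (r\<inverse>) d X v (\<lambda>k x. - M k x) N \<and>
      (\<forall>x\<in>X. \<forall>y\<in>X. \<gamma> x = \<gamma> y \<longrightarrow> (N x < N y \<longleftrightarrow> NN' (\<gamma> x) x < NN' (\<gamma> x) y)) \<and>
      (\<forall>x\<in>X. \<forall>y\<in>X. (x, \<gamma> x) \<notin> r\<inverse> \<longrightarrow> - L 0 (\<gamma> x) < - L 0 (\<gamma> y) \<longrightarrow> N y < N x)"
    proof (rule one_sided_block[where C = C and L = "\<lambda>k x. - L k x" and MM = "\<lambda>g k x. - MM g k x"])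
      show "trans (r\<inverse>)" using tr by simp
      show "(x, \<gamma> x) \<in> r\<inverse> \<and> (\<gamma> x, \<gamma> y) \<in> r\<inverse> \<and> (\<gamma> y, y) \<in> r\<inverse>"
        if "x \<in> X" "y \<in> X" "\<gamma> x \<noteq> \<gamma> y" "(x, y) \<in> r\<inverse>" for x y
        using cross[of y x] that by auto
      show "linext C (r\<inverse>) (\<lambda>x. - L k x)" if "k < d" for k using L[OF that] by (simp add: linext_uminus)
      show "\<exists>k<d. - L k y < - L k x" if "x \<in> C" "y \<in> C" "(x, y) \<notin> r\<inverse>" for x y
        using Lrev[of y x] that by auto
      show "- M k x < - M k y \<longleftrightarrow> - L k (\<gamma> x) < - L k (\<gamma> y) \<or>
          \<gamma> x = \<gamma> y \<and> - MM (\<gamma> x) k x < - MM (\<gamma> x) k y" if "k < d" "x \<in> X" "y \<in> X" for k x y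
        using M[OF that(1,3,2)] by auto
    qed (use fin gX CX gC v gv refl d h' in auto)
    then show ?thesis using that by auto
  qed
  have "(\<exists>k<d. M k y < M k x) \<or> N y < N x \<or> N' x < N' y"
    if xy: "x \<in> X" "y \<in> X" "(x, y) \<notin> r" for x y
  proof (cases "\<gamma> x = \<gamma> y")
    case True
    then show ?thesis using rev[OF xy(1,2) True xy(3)] xy M Na[of y x] Na'[of x y] by auto
  next
    case False
    then consider "L 0 (\<gamma> y) < L 0 (\<gamma> x)" | (2) "L 0 (\<gamma> x) < L 0 (\<gamma> y)"
      using Linj[OF d xy(1,2)] by linarith
    then show ?thesis
    proof cases
      case 1
      then show ?thesis using M[OF d xy(2,1)] d by blast
    next
      case 2
      consider "(x, \<gamma> x) \<notin> r" | "(\<gamma> y, y) \<notin> r" | "(\<gamma> x, \<gamma> y) \<notin> r"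
        using xy(3) tr by (blast dest: transD)
      then show ?thesis
      proof cases
        case 1
        then show ?thesis using Nc[OF xy(1,2) _ 2] by blast
      next
        case 2
        then show ?thesis using Nc'[OF xy(2,1)] \<open>L 0 (\<gamma> x) < L 0 (\<gamma> y)\<close> by auto
      next
        case 3
        then show ?thesis using Lrev[OF gX[OF xy(1)] gX[OF xy(2)]] M xy by blast
      qed
    qed
  qed
  then show ?thesis unfolding rooted_def rooted_by_def using Mlin N N' by blast
qed

text \<open>The vertex \<open>v\<close> is put first in all \<open>M k\<close>, in \<open>N\<close>
  and in \<open>N'\<close>. The negative of \<open>N'\<close> thus ends with \<open>v\<close>, so
  pairs with \<open>v\<close> are reversed in both directions.\<close>

lemma rooted_isolated:
  assumes fin: "finite X" and v: "v \<in> X" and d: "0 < d"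
    and vv: "(v, v) \<in> r"
    and iso: "\<And>x. x \<in> X \<Longrightarrow> x \<noteq> v \<Longrightarrow> (x, v) \<notin> r \<and> (v, x) \<notin> r"
    and r: "rooted r d (X - {v}) g"
  shows "rooted r d X v"
proof -
  from r obtain M0 N0 N0' where M0: "\<And>k. k < d \<Longrightarrow> linext (X - {v}) r (M0 k)"
    and N0: "one_sided r d (X - {v}) g M0 N0" and N0': "one_sided (r\<inverse>) d (X - {v}) g (\<lambda>k x. - M0 k x) N0'"
    and rev: "\<And>x y. x \<in> X - {v} \<Longrightarrow> y \<in> X - {v} \<Longrightarrow> (x, y) \<notin> r \<Longrightarrow>
      (\<exists>k<d. M0 k y < M0 k x) \<or> N0 y < N0 x \<or> N0' x < N0' y"
    unfolding rooted_def rooted_by_def by blast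
  define B where "B = (\<lambda>f :: 'a \<Rightarrow> int. lex_rank X (\<lambda>x. if x = v then 0 else 1) f)"
  have Bv: "B f v < B f x" "\<not> B f x < B f v" if "x \<in> X" "x \<noteq> v" for f x
    using that v fin by (auto simp: B_def lex_rank_less_iff)
  have B: "B f x < B f y \<longleftrightarrow> f x < f y" if "x \<in> X - {v}" "y \<in> X - {v}" for f x y
    using that fin by (auto simp: B_def lex_rank_less_iff)
  have Blin: "linext X s (B f)" if "linext (X - {v}) s f"
    and "\<And>x. x \<in> X \<Longrightarrow> x \<noteq> v \<Longrightarrow> (x, v) \<notin> s" for f and s :: "'a rel"
    unfolding B_def
  proof (rule linext_lex_rank[OF fin])
    show "inj_on (\<lambda>x. (if x = v then 0 else 1 :: int, f x)) X"
      using that(1) by (auto simp: linext_def inj_on_def)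
    show "(if x = v then 0 else 1 :: int) < (if y = v then 0 else 1) \<or>
      (if x = v then 0 else 1 :: int) = (if y = v then 0 else 1) \<and> f x \<le> f y"
      if "x \<in> X" "y \<in> X" "(x, y) \<in> s" for x y
      using that \<open>linext (X - {v}) s f\<close> \<open>\<And>x. x \<in> X \<Longrightarrow> x \<noteq> v \<Longrightarrow> (x, v) \<notin> s\<close>[of x]
      by (auto simp: linext_def)
  qed
  have "one_sided r d X v (\<lambda>k. B (M0 k)) (B N0)"
  proof (rule one_sidedI)
    show "linext X r (B N0)" using N0 iso by (intro Blin) (auto simp: one_sided_def)
  qed (use Bv d vv in blast)+
  moreover have "one_sided (r\<inverse>) d X v (\<lambda>k x. - B (M0 k) x) (B N0')"
    unfolding one_sided_def
  \<comment> \<open>In the negated \<open>M k\<close> every other element precedes \<open>v\<close>,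
    so the final segment has to be everything except \<open>v\<close>.\<close>
  proof (intro conjI exI[of _ "X - {v}"])
    show "linext X (r\<inverse>) (B N0')" using N0' iso by (intro Blin) (auto simp: one_sided_def)
  qed (use Bv iso vv in auto)
  moreover have "(\<exists>k<d. B (M0 k) y < B (M0 k) x) \<or> B N0 y < B N0 x \<or> B N0' x < B N0' y"
    if xy: "x \<in> X" "y \<in> X" "(x, y) \<notin> r" for x y
  proof -
    consider "x = v" "y \<noteq> v" | "y = v" "x \<noteq> v" | "x \<in> X - {v}" "y \<in> X - {v}"
      using xy vv by auto
    then show ?thesis
    proof cases
      case 3
      then show ?thesis using rev[OF 3 xy(3)] B by auto
    qed (use Bv xy in auto)
  qed
  moreover have "linext X r (B (M0 k))" if "k < d" for k
    using M0[OF that] iso by (intro Blin) auto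
  ultimately show ?thesis
    unfolding rooted_def rooted_by_def
    by (intro exI[of _ "\<lambda>k. B (M0 k)"] exI[of _ "B N0"] exI[of _ "B N0'"]) blast
qed

section \<open>Separations of the cover graph\<close>

locale finite_poset =
  fixes P :: "'a set" and r :: "'a rel"
  assumes fin: "finite P" and po: "partial_order_on P r"
begin

lemma refl_r: "x \<in> P \<Longrightarrow> (x, x) \<in> r"
  using po by (simp add: partial_order_on_def preorder_on_def refl_on_def)

lemma trans_rel: "trans r"
  using po by (simp add: partial_order_on_def preorder_on_def)

lemma trans_r: "(x, y) \<in> r \<Longrightarrow> (y, z) \<in> r \<Longrightarrow> (x, z) \<in> r"
  using trans_rel by (rule transD)

lemma antisym_r: "(x, y) \<in> r \<Longrightarrow> (y, x) \<in> r \<Longrightarrow> x = y"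
  using po by (auto simp: partial_order_on_def dest: antisymD)

lemma in_P: "(x, y) \<in> r \<Longrightarrow> x \<in> P" "(x, y) \<in> r \<Longrightarrow> y \<in> P"
  using po by (auto simp: partial_order_on_def preorder_on_def refl_on_def)

definition adj :: "'a \<Rightarrow> 'a \<Rightarrow> bool" where
  "adj x y \<longleftrightarrow> covers P r y x \<or> covers P r x y"

lemma adj_sym: "adj x y \<Longrightarrow> adj y x"
  by (auto simp: adj_def)

text \<open>On such a set the covers of the induced order are covers in \<open>P\<close>, so
  \<open>r\<close> and \<open>adj\<close> can stay fixed throughout the induction.\<close>

definition order_convex :: "'a set \<Rightarrow> bool" where
  "order_convex X \<longleftrightarrow> X \<subseteq> P \<and> (\<forall>x\<in>X. \<forall>y\<in>X. \<forall>z. (x, z) \<in> r \<longrightarrow> (z, y) \<in> r \<longrightarrow> z \<in> X)"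

text \<open>Interval size is the measure for the inductions along chains of covers.\<close>

lemma card_interval_less:
  assumes "(x, x') \<in> r" "(x', y') \<in> r" "(y', y) \<in> r" "x \<noteq> x' \<or> y' \<noteq> y"
  shows "card {w. (x', w) \<in> r \<and> (w, y') \<in> r} < card {w. (x, w) \<in> r \<and> (w, y) \<in> r}"
proof (rule psubset_card_mono)
  show "finite {w. (x, w) \<in> r \<and> (w, y) \<in> r}"
    by (rule finite_subset[OF _ fin]) (auto dest: in_P)
  have xy: "(x, y) \<in> r" using assms trans_r by blast
  have "x \<in> {w. (x, w) \<in> r \<and> (w, y) \<in> r}" "y \<in> {w. (x, w) \<in> r \<and> (w, y) \<in> r}"
    using xy refl_r in_P by blast+
  moreover have "x \<notin> {w. (x', w) \<in> r \<and> (w, y') \<in> r} \<or> y \<notin> {w. (x', w) \<in> r \<and> (w, y') \<in> r}"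
    using assms antisym_r by blast
  moreover have "{w. (x', w) \<in> r \<and> (w, y') \<in> r} \<subseteq> {w. (x, w) \<in> r \<and> (w, y) \<in> r}"
    using assms trans_r by blast
  ultimately show "{w. (x', w) \<in> r \<and> (w, y') \<in> r} \<subset> {w. (x, w) \<in> r \<and> (w, y) \<in> r}"
    by blast
qed

lemma cover_above:
  assumes "(x, y) \<in> r" "x \<noteq> y"
  obtains z where "covers P r z x" "(z, y) \<in> r"
proof -
  have "\<exists>z. covers P r z x \<and> (z, y) \<in> r"
    using assms
  proof (induction "card {w. (x, w) \<in> r \<and> (w, y) \<in> r}" arbitrary: y rule: less_induct)
    case less
    show ?case
    proof (cases "covers P r y x")
      case True
      then show ?thesis using refl_r less.prems in_P by blast
    next
      case False
      then obtain z where z: "(x, z) \<in> r" "x \<noteq> z" "(z, y) \<in> r" "z \<noteq> y"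
        using less.prems in_P unfolding covers_def by blast
      have "card {w. (x, w) \<in> r \<and> (w, z) \<in> r} < card {w. (x, w) \<in> r \<and> (w, y) \<in> r}"
        using z in_P refl_r by (intro card_interval_less) auto
      from less.hyps[OF this z(1,2)] show ?thesis using z trans_r by blast
    qed
  qed
  then show thesis using that by blast
qed

text \<open>Climb from \<open>x\<close> to \<open>y\<close> along covers; by convexity the chain
  stays in \<open>X\<close>, and some step of it crosses the boundary of \<open>Y\<close>.\<close>

lemma crossing_edge:
  assumes "order_convex X" "x \<in> X" "y \<in> X" "(x, y) \<in> r" "x \<in> Y \<longleftrightarrow> y \<notin> Y"
  shows "\<exists>a\<in>X \<inter> Y. \<exists>b\<in>X - Y. adj a b \<and> (x, a) \<in> r \<and> (a, y) \<in> r"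
  using assms(2,4,5)
proof (induction "card {w. (x, w) \<in> r \<and> (w, y) \<in> r}" arbitrary: x rule: less_induct)
  case less
  have "x \<noteq> y" using less.prems by auto
  then obtain z where z: "covers P r z x" "(z, y) \<in> r"
    using cover_above less.prems by blast
  then have xz: "(x, z) \<in> r" "x \<noteq> z" by (auto simp: covers_def)
  have zX: "z \<in> X" using assms(1,3) less.prems(1) xz z(2) unfolding order_convex_def by blast
  have xx: "(x, x) \<in> r" using xz in_P refl_r by blast
  show ?case
  proof (cases "z \<in> Y \<longleftrightarrow> x \<in> Y")
    case True
    have "card {w. (z, w) \<in> r \<and> (w, y) \<in> r} < card {w. (x, w) \<in> r \<and> (w, y) \<in> r}"
      using xz z(2) in_P refl_r by (intro card_interval_less) auto
    from less.hyps[OF this zX z(2)] True less.prems(3) show ?thesis using xz trans_r by blast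
  next
    case False
    have "adj x z" "adj z x" using z(1) by (auto simp: adj_def)
    then show ?thesis using False less.prems zX xz z(2) xx by blast
  qed
qed

text \<open>The end in \<open>Y\<close> of the crossing edge can only be \<open>v\<close>:
  comparabilities across a cutvertex pass through it.\<close>

lemma separator:
  assumes "order_convex X" "Y \<subseteq> X" "\<And>a b. a \<in> Y \<Longrightarrow> b \<in> X - Y \<Longrightarrow> adj a b \<Longrightarrow> a = v"
    and "x \<in> X" "y \<in> X" "x \<in> Y \<longleftrightarrow> y \<notin> Y" "(x, y) \<in> r"
  shows "(x, v) \<in> r \<and> (v, y) \<in> r"
  using crossing_edge[OF assms(1,4,5,7,6)] assms(2,3) by blast

text \<open>A chain that leaves \<open>Y\<close> and returns passes through \<open>v\<close> twice,
  so an outside element would be both above and below \<open>v\<close>.\<close>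

lemma order_convex_part:
  assumes X: "order_convex X" "Y \<subseteq> X" "\<And>a b. a \<in> Y \<Longrightarrow> b \<in> X - Y \<Longrightarrow> adj a b \<Longrightarrow> a = v"
    and v: "v \<in> Y"
  shows "order_convex Y"
  unfolding order_convex_def
proof (intro conjI ballI allI impI)
  show "Y \<subseteq> P" using X by (auto simp: order_convex_def)
  fix x y z assume xyz: "x \<in> Y" "y \<in> Y" "(x, z) \<in> r" "(z, y) \<in> r"
  show "z \<in> Y"
  proof (rule ccontr)
    assume nz: "z \<notin> Y"
    have "z \<in> X" using X(1,2) xyz unfolding order_convex_def by blast
    then have "(v, z) \<in> r" "(z, v) \<in> r"
      using separator[OF X(1,2), of v x z] separator[OF X(1,2), of v z y] X(3) nz xyz X(2) by blast+
    then show False using antisym_r nz v by blast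
  qed
qed

section \<open>Connectivity and the block at a root\<close>

definition separation :: "'a set \<Rightarrow> 'a set \<Rightarrow> 'a set \<Rightarrow> bool" where
  "separation A B X \<longleftrightarrow> A \<noteq> {} \<and> B \<noteq> {} \<and> A \<inter> B = {} \<and> A \<union> B = X \<and> (\<forall>a\<in>A. \<forall>b\<in>B. \<not> adj a b)"

text \<open>The empty set counts as connected, so that a single vertex is
  \<open>biconn\<close>.\<close>

definition conn :: "'a set \<Rightarrow> bool" where
  "conn X \<longleftrightarrow> (\<nexists>A B. separation A B X)"

definition biconn :: "'a set \<Rightarrow> bool" where
  "biconn X \<longleftrightarrow> X \<noteq> {} \<and> conn X \<and> (\<forall>w\<in>X. conn (X - {w}))"

lemma separation_sym: "separation A B X \<Longrightarrow> separation B A X"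
  by (auto simp: separation_def adj_def)

text \<open>\<open>\<gamma> x\<close> is the vertex of \<open>C\<close> at which \<open>x\<close> hangs. A block through \<open>v\<close> is obtained as a set \<open>C\<close>
  of least size for which such a map exists.\<close>

definition gated :: "'a set \<Rightarrow> 'a \<Rightarrow> 'a set \<Rightarrow> ('a \<Rightarrow> 'a) \<Rightarrow> bool" where
  "gated X v C \<gamma> \<longleftrightarrow> C \<subseteq> X \<and> v \<in> C \<and> 2 \<le> card C \<and> (\<forall>x\<in>X. \<gamma> x \<in> C) \<and> (\<forall>g\<in>C. \<gamma> g = g) \<and>
     (\<forall>x\<in>X. \<gamma> x = v \<longrightarrow> x = v) \<and>
     (\<forall>x\<in>X. \<forall>y\<in>X. adj x y \<longrightarrow> \<gamma> x \<noteq> \<gamma> y \<longrightarrow> x \<in> C \<and> y \<in> C)"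

text \<open>Pull the separation back along \<open>\<gamma>\<close>: an edge between elements hanging
  at different vertices lies in \<open>C\<close>, and only \<open>v\<close> hangs at
  \<open>v\<close>.\<close>

lemma gated_lift:
  assumes g: "gated X v C \<gamma>" and s: "separation A B (C - {v})"
  shows "\<not> conn (X - {v})"
proof -
  have "separation {x \<in> X. \<gamma> x \<in> A} {x \<in> X. \<gamma> x \<in> B} (X - {v})"
    unfolding separation_def
  proof (intro conjI ballI)
    have AB: "A \<subseteq> C - {v}" "B \<subseteq> C - {v}" using s by (auto simp: separation_def)
    have e: "x \<in> X" "\<gamma> x = x" if "x \<in> C - {v}" for x using g that by (auto simp: gated_def)
    have eA: "a \<in> {x \<in> X. \<gamma> x \<in> A}" if "a \<in> A" for a
      using e[of a] subsetD[OF AB(1) that] that by simp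
    have eB: "b \<in> {x \<in> X. \<gamma> x \<in> B}" if "b \<in> B" for b
      using e[of b] subsetD[OF AB(2) that] that by simp
    obtain a b where "a \<in> A" "b \<in> B" using s unfolding separation_def by blast
    from eA[OF this(1)] eB[OF this(2)]
    show "{x \<in> X. \<gamma> x \<in> A} \<noteq> {}" "{x \<in> X. \<gamma> x \<in> B} \<noteq> {}" by blast+
    show "{x \<in> X. \<gamma> x \<in> A} \<inter> {x \<in> X. \<gamma> x \<in> B} = {}" using s by (auto simp: separation_def)
    show "{x \<in> X. \<gamma> x \<in> A} \<union> {x \<in> X. \<gamma> x \<in> B} = X - {v}"
    proof (intro equalityI subsetI)
      fix x assume "x \<in> {x \<in> X. \<gamma> x \<in> A} \<union> {x \<in> X. \<gamma> x \<in> B}"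
      then show "x \<in> X - {v}" using AB g by (auto simp: gated_def)
    next
      fix x assume x: "x \<in> X - {v}"
      then have "\<gamma> x \<in> C - {v}" using g by (auto simp: gated_def)
      then show "x \<in> {x \<in> X. \<gamma> x \<in> A} \<union> {x \<in> X. \<gamma> x \<in> B}" using x s by (auto simp: separation_def)
    qed
    fix a b assume ab: "a \<in> {x \<in> X. \<gamma> x \<in> A}" "b \<in> {x \<in> X. \<gamma> x \<in> B}"
    show "\<not> adj a b"
    proof
      assume "adj a b"
      moreover have "\<gamma> a \<noteq> \<gamma> b" using ab s by (auto simp: separation_def)
      ultimately have "a \<in> C" "b \<in> C" using g ab unfolding gated_def by blast+
      then have "a \<in> A" "b \<in> B" using g ab by (auto simp: gated_def)
      then show False using \<open>adj a b\<close> s by (auto simp: separation_def)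
    qed
  qed
  then show ?thesis by (auto simp: conn_def)
qed

text \<open>If \<open>w\<close> separates \<open>C\<close>, the side \<open>B\<close> without
  \<open>v\<close> can be made to hang at \<open>w\<close> together with everything that hangs on
  it. This is the descent step towards a block.\<close>

lemma gated_shrink:
  assumes g: "gated X v C \<gamma>" and fin: "finite X" and s: "separation A B (C - {w})"
    and w: "w \<in> C" and v: "v \<in> A"
  shows "gated X v (A \<union> {w}) (\<lambda>x. if \<gamma> x \<in> B then w else \<gamma> x)"
  unfolding gated_def
proof (intro conjI ballI impI)
  have AB: "A \<subseteq> C - {w}" "B \<subseteq> C - {w}" "A \<inter> B = {}" "A \<union> B = C - {w}"
    and nadj: "\<And>a b. a \<in> A \<Longrightarrow> b \<in> B \<Longrightarrow> \<not> adj a b"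
    using s by (auto simp: separation_def)
  have CX: "C \<subseteq> X" using g by (auto simp: gated_def)
  show "A \<union> {w} \<subseteq> X" "v \<in> A \<union> {w}" using AB CX w v by auto
  have "{v, w} \<subseteq> A \<union> {w}" "v \<noteq> w" using v AB by auto
  then show "2 \<le> card (A \<union> {w})"
    using card_mono[of "A \<union> {w}" "{v, w}"] finite_subset[OF \<open>A \<union> {w} \<subseteq> X\<close> fin] by simp
  show "(if \<gamma> x \<in> B then w else \<gamma> x) \<in> A \<union> {w}" if "x \<in> X" for x
    using that g AB by (auto simp: gated_def)
  show "(if \<gamma> x \<in> B then w else \<gamma> x) = x" if "x \<in> A \<union> {w}" for x
  proof -
    have "\<gamma> x = x" using that g AB w by (auto simp: gated_def)
    then show ?thesis using that AB by auto
  qed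
  show "x = v" if "x \<in> X" "(if \<gamma> x \<in> B then w else \<gamma> x) = v" for x
    using that g v AB by (auto simp: gated_def split: if_splits)
  fix x y assume xy: "x \<in> X" "y \<in> X" "adj x y"
    "(if \<gamma> x \<in> B then w else \<gamma> x) \<noteq> (if \<gamma> y \<in> B then w else \<gamma> y)"
  have "\<gamma> x \<noteq> \<gamma> y" using xy(4) by metis
  then have "x \<in> C" "y \<in> C" using g xy(1-3) unfolding gated_def by blast+
  then have C: "x \<in> C" "y \<in> C" "\<gamma> x = x" "\<gamma> y = y" using g by (auto simp: gated_def)
  have *: "a \<notin> B" if "b \<in> C" "\<gamma> b = b" "\<gamma> a = a" "adj a b"
    "(if \<gamma> a \<in> B then w else \<gamma> a) \<noteq> (if \<gamma> b \<in> B then w else \<gamma> b)" for a b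
  proof
    assume a: "a \<in> B"
    then have "b \<notin> B" "b \<noteq> w" using that by (auto split: if_splits)
    then have "b \<in> A" using that(1) AB by blast
    then show False using nadj a adj_sym[OF that(4)] by blast
  qed
  have "x \<notin> B" by (rule *[OF C(2,4,3) xy(3,4)])
  moreover have "y \<notin> B" by (rule *[OF C(1,3,4) adj_sym[OF xy(3)] not_sym[OF xy(4)]])
  ultimately show "x \<in> A \<union> {w}" "y \<in> A \<union> {w}" using AB C by auto
qed

text \<open>Minimize \<open>C\<close>, starting from \<open>X\<close> with the identity.
  \<open>gated_lift\<close> excludes \<open>v\<close> as a cutvertex of \<open>C\<close>, and
  minimality with \<open>gated_shrink\<close> excludes the others. A separation of \<open>C\<close>
  itself would separate \<open>C - {v}\<close> or isolate \<open>v\<close>, whose neighbour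
  \<open>x\<close> lies in \<open>C\<close>.\<close>

lemma block_exists:
  assumes fin: "finite X" and v: "v \<in> X" and X: "2 \<le> card X" and con: "conn (X - {v})"
    and x: "x \<in> X" "adj v x"
  obtains C \<gamma> where "gated X v C \<gamma>" "biconn C"
proof -
  have "gated X v X id" using v X by (auto simp: gated_def)
  then obtain C \<gamma> where g: "gated X v C \<gamma>"
    and min: "\<And>C' \<gamma>'. gated X v C' \<gamma>' \<Longrightarrow> card C \<le> card C'"
    using ex_has_least_nat[of "\<lambda>(C, \<gamma>). gated X v C \<gamma>" "(X, id)" "\<lambda>(C, \<gamma>). card C"] by auto
  have vC: "v \<in> C" and finC: "finite C" using g fin by (auto simp: gated_def intro: finite_subset)
  have nov: "\<not> separation A B (C - {v})" for A B using gated_lift[OF g] con by blast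
  have now: "\<not> separation A B (C - {w})" if w: "w \<in> C" for A B w
  proof
    assume s: "separation A B (C - {w})"
    then have "w \<noteq> v" using nov by blast
    have False if s: "separation A B (C - {w})" and "v \<in> A" for A B
    proof -
      have "gated X v (A \<union> {w}) (\<lambda>x. if \<gamma> x \<in> B then w else \<gamma> x)"
        by (rule gated_shrink[OF g fin s w that(2)])
      then have "card C \<le> card (A \<union> {w})" by (rule min)
      moreover have "A \<union> {w} \<subset> C" using s w by (auto simp: separation_def)
      ultimately show False using psubset_card_mono[OF finC, of "A \<union> {w}"] by linarith
    qed
    moreover have "v \<in> A \<or> v \<in> B" using s vC \<open>w \<noteq> v\<close> by (auto simp: separation_def)
    ultimately show False using s separation_sym by blast
  qed
  have "\<not> separation A B C" for A B
  proof
    assume s: "separation A B C"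
    have False if s: "separation A B C" and vA: "v \<in> A" for A B
    proof (cases "A = {v}")
      case True
      have "x \<noteq> v" using x(2) by (auto simp: adj_def covers_def)
      then have "\<gamma> v \<noteq> \<gamma> x" using g x vC unfolding gated_def by metis
      then have "x \<in> C" using g x v unfolding gated_def by blast
      then have "x \<in> B" using s True \<open>x \<noteq> v\<close> by (auto simp: separation_def)
      then show False using s True x(2) by (auto simp: separation_def)
    next
      case False
      then have "separation (A - {v}) B (C - {v})" using s vA by (auto simp: separation_def)
      then show False using nov by blast
    qed
    moreover have "v \<in> A \<or> v \<in> B" using s vC by (auto simp: separation_def)
    ultimately show False using s separation_sym by blast
  qed
  then have "biconn C" using now vC by (auto simp: biconn_def conn_def)
  then show thesis using that g by blast
qed

text \<open>The elements hanging at a vertex \<open>h\<close> are joined to the rest of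
  \<open>X\<close> only through \<open>h\<close>. So \<open>separator\<close> applies first at
  \<open>\<gamma> x\<close> to \<open>x\<close> and \<open>y\<close>, then at
  \<open>\<gamma> y\<close> to \<open>\<gamma> x\<close> and \<open>y\<close>.\<close>

lemma gated_cross:
  assumes X: "order_convex X" and g: "gated X v C \<gamma>"
    and xy: "x \<in> X" "y \<in> X" "\<gamma> x \<noteq> \<gamma> y" "(x, y) \<in> r"
  shows "(x, \<gamma> x) \<in> r \<and> (\<gamma> x, \<gamma> y) \<in> r \<and> (\<gamma> y, y) \<in> r"
proof -
  have sep: "(a, h) \<in> r \<and> (h, b) \<in> r"
    if "a \<in> X" "b \<in> X" "\<gamma> a = h \<longleftrightarrow> \<gamma> b \<noteq> h" "(a, b) \<in> r" for a b h
  proof (rule separator[OF X, of "{z \<in> X. \<gamma> z = h}"])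
    show "c = h" if "c \<in> {z \<in> X. \<gamma> z = h}" "e \<in> X - {z \<in> X. \<gamma> z = h}" "adj c e" for c e
    proof -
      have e: "c \<in> X" "e \<in> X" "\<gamma> c = h" "\<gamma> e \<noteq> h" using that by auto
      then have "\<gamma> c \<noteq> \<gamma> e" by auto
      then have "c \<in> C" using g e that(3) unfolding gated_def by blast
      then show ?thesis using g e unfolding gated_def by auto
    qed
  qed (use that in auto)
  have gx: "\<gamma> x \<in> X" "\<gamma> (\<gamma> x) = \<gamma> x" using g xy by (auto simp: gated_def)
  have 1: "(x, \<gamma> x) \<in> r" "(\<gamma> x, y) \<in> r" using sep[of x y "\<gamma> x"] xy by auto
  then show ?thesis using sep[of "\<gamma> x" y "\<gamma> y"] gx xy by auto
qed

text \<open>Induction on the size of \<open>X\<close> for all roots: \<open>v\<close> is the only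
  vertex, has no neighbour, is a cutvertex, or lies in a single block. In the last case what hangs
  at each vertex of the block is rooted there by induction and substituted into the block.\<close>

lemma rooted_blocks:
  assumes "0 < d" "order_convex X" "v \<in> X"
    and "\<And>C. C \<subseteq> X \<Longrightarrow> order_convex C \<Longrightarrow> biconn C \<Longrightarrow> dim_le C r d"
  shows "rooted r d X v"
  using assms(2-4)
proof (induction "card X" arbitrary: X v rule: less_induct)
  case less
  have XP: "X \<subseteq> P" using less.prems by (auto simp: order_convex_def)
  then have finX: "finite X" using fin finite_subset by blast
  have vv: "(v, v) \<in> r" using refl_r XP less.prems by blast
  have IH: "rooted r d Y w" if "Y \<subset> X" "order_convex Y" "w \<in> Y" for Y w
    using less.hyps[of Y w] that less.prems(3) psubset_card_mono[OF finX that(1)] by blast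
  consider "X = {v}" | "X \<noteq> {v}" "\<forall>x\<in>X. \<not> adj v x" | A B where "separation A B (X - {v})"
    | x where "X \<noteq> {v}" "x \<in> X" "adj v x" "conn (X - {v})"
    unfolding conn_def by blast
  then show ?case
  proof cases
    case 1
    then show ?thesis using rooted_singleton[OF vv] by simp
  next
    case 2
    then obtain g where g: "g \<in> X - {v}" using less.prems by blast
    have iso: "(x, v) \<notin> r \<and> (v, x) \<notin> r" if "x \<in> X" "x \<noteq> v" for x
      using crossing_edge[OF less.prems(1), of x v "{v}"] crossing_edge[OF less.prems(1), of v x "{v}"]
        that less.prems(2) 2 by auto
    have "order_convex (X - {v})"
      using less.prems(1) iso unfolding order_convex_def by blast
    then have "rooted r d (X - {v}) g" using g less.prems by (intro IH) auto
    then show ?thesis using rooted_isolated[OF finX less.prems(2) assms(1) vv iso] by blast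
  next
    case 3
    have main: "A \<union> {v} \<subset> X \<and> order_convex (A \<union> {v}) \<and>
        (\<forall>x\<in>A \<union> {v}. \<forall>y\<in>B \<union> {v}. (x, y) \<in> r \<longrightarrow> (x, v) \<in> r \<and> (v, y) \<in> r)"
      if s: "separation A B (X - {v})" for A B
    proof -
      have sub: "A \<union> {v} \<subseteq> X" and edge: "a = v" if "a \<in> A \<union> {v}" "b \<in> X - (A \<union> {v})" "adj a b" for a b
        using that s less.prems(2) by (auto simp: separation_def)
      have "A \<union> {v} \<subset> X" using s less.prems(2) by (auto simp: separation_def)
      moreover have "order_convex (A \<union> {v})"
        using calculation edge by (intro order_convex_part[OF less.prems(1)]) auto
      moreover have "(x, v) \<in> r \<and> (v, y) \<in> r"
        if xy: "x \<in> A \<union> {v}" "y \<in> B \<union> {v}" "(x, y) \<in> r" for x y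
      proof (cases "x = v \<or> y = v")
        case True
        then show ?thesis using xy vv by auto
      next
        case False
        then have "x \<in> A" "y \<in> B" "y \<notin> A \<union> {v}" "x \<in> X" "y \<in> X" using xy s by (auto simp: separation_def)
        then show ?thesis
          using separator[OF less.prems(1), of "A \<union> {v}" v x y] edge calculation(1) xy(3) by blast
      qed
      ultimately show ?thesis by blast
    qed
    note m1 = main[OF 3] and m2 = main[OF separation_sym[OF 3]]
    have "rooted r d ((A \<union> {v}) \<union> (B \<union> {v})) v"
    proof (rule rooted_merge[OF _ _ assms(1) _ trans_rel vv])
      show "finite (A \<union> {v})" "finite (B \<union> {v})" using m1 m2 finX finite_subset by blast+
      show "(A \<union> {v}) \<inter> (B \<union> {v}) = {v}" using 3 by (auto simp: separation_def)
      show "rooted r d (A \<union> {v}) v" using m1 by (intro IH) auto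
      show "rooted r d (B \<union> {v}) v" using m2 by (intro IH) auto
    qed (use m1 m2 in blast)+
    moreover have "(A \<union> {v}) \<union> (B \<union> {v}) = X" using 3 less.prems(2) by (auto simp: separation_def)
    ultimately show ?thesis by simp
  next
    case 4
    have "card X \<ge> 2"
    proof -
      have "card X \<noteq> 0" "card X \<noteq> 1" using 4 finX less.prems(2) by (auto simp: card_1_singleton_iff)
      then show ?thesis by simp
    qed
    then obtain C \<gamma> where g: "gated X v C \<gamma>" and C: "biconn C"
      using block_exists[OF finX less.prems(2) _ 4(4,2,3)] by blast
    note cross = gated_cross[OF less.prems(1) g]
    have gC: "\<gamma> h = h" if "h \<in> C" for h using g that by (auto simp: gated_def)
    have CX: "C \<subseteq> X" using g by (auto simp: gated_def)
    have "order_convex C"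
      \<comment> \<open>If \<open>z\<close> between two elements of \<open>C\<close> were outside
        \<open>C\<close>, it would be both above and below the vertex at which it hangs.\<close>
      unfolding order_convex_def
    proof (intro conjI ballI allI impI)
      show "C \<subseteq> P" using CX XP by blast
      fix x y z assume xyz: "x \<in> C" "y \<in> C" "(x, z) \<in> r" "(z, y) \<in> r"
      then have z: "z \<in> X" using less.prems(1) CX unfolding order_convex_def by blast
      show "z \<in> C"
      proof (rule ccontr)
        assume nz: "z \<notin> C"
        have gz: "\<gamma> z \<in> C" using g z by (auto simp: gated_def)
        have "(\<gamma> z, z) \<in> r" using cross[of x z] xyz z gC CX by (cases "\<gamma> x = \<gamma> z") auto
        moreover have "(z, \<gamma> z) \<in> r" using cross[of z y] xyz z gC CX by (cases "\<gamma> z = \<gamma> y") auto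
        ultimately show False using antisym_r gz nz by metis
      qed
    qed
    then have dim: "dim_le C r d" using less.prems(3) CX C by blast
    show ?thesis
    proof (rule rooted_block[OF finX _ CX gC _ _ _ trans_rel assms(1) cross dim])
      show "\<gamma> x \<in> C" if "x \<in> X" for x using g that by (auto simp: gated_def)
      show "v \<in> C" using g by (auto simp: gated_def)
      show "x = v" if "x \<in> X" "\<gamma> x = v" for x using g that by (auto simp: gated_def)
      show "(x, x) \<in> r" if "x \<in> X" for x using that XP refl_r by blast
      fix h assume h: "h \<in> C"
      show "rooted r d {x \<in> X. \<gamma> x = h} h"
      proof (rule IH)
        \<comment> \<open>A block has at least two vertices, so what hangs at \<open>h\<close> is a
          proper part of \<open>X\<close> and the induction hypothesis applies.\<close>
        have "\<not> C \<subseteq> {h}"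
        proof
          assume "C \<subseteq> {h}"
          then have "card C \<le> 1" using card_mono[of "{h}" C] by simp
          then show False using g by (auto simp: gated_def)
        qed
        then obtain b where "b \<in> C" "b \<noteq> h" by blast
        then have "b \<in> X" "\<gamma> b \<noteq> h" using gC CX by auto
        then show "{x \<in> X. \<gamma> x = h} \<subset> X" by blast
        show "h \<in> {x \<in> X. \<gamma> x = h}" using h gC CX by auto
        then show "order_convex {x \<in> X. \<gamma> x = h}"
        proof (intro order_convex_part[OF less.prems(1)])
          show "c = h" if c: "c \<in> {x \<in> X. \<gamma> x = h}" "e \<in> X - {x \<in> X. \<gamma> x = h}" "adj c e" for c e
          proof -
            have e: "c \<in> X" "e \<in> X" "\<gamma> c = h" "\<gamma> e \<noteq> h" using c by auto
            then have "\<gamma> c \<noteq> \<gamma> e" by auto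
            then have "c \<in> C" using g e c(3) unfolding gated_def by blast
            then show ?thesis using gC e by auto
          qed
        qed auto
      qed
    qed
  qed
qed

section \<open>Bounding the dimension by colours\<close>

lemma linext_exists: "\<exists>f. linext P r f"
proof -
  obtain l where l: "linear_order_on P l" "r \<subseteq> l" using linear_extension_exists[OF fin po] by blast
  then have l': "trans l" "antisym l" "total_on P l" "l \<subseteq> P \<times> P" "\<And>x. x \<in> P \<Longrightarrow> (x, x) \<in> l"
    by (auto simp: order_on_defs refl_on_def)
  define f where "f x = int (card {z. (z, x) \<in> l})" for x
  have less: "f x < f y" if "(x, y) \<in> l" "x \<noteq> y" for x y
  proof -
    have "{z. (z, x) \<in> l} \<subset> {z. (z, y) \<in> l}"
    proof
      show "{z. (z, x) \<in> l} \<subseteq> {z. (z, y) \<in> l}" using that l'(1) by (blast dest: transD)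
      have "y \<in> P" "(y, x) \<notin> l" using that l'(2,4) by (auto dest: antisymD)
      then show "{z. (z, x) \<in> l} \<noteq> {z. (z, y) \<in> l}" using l'(5) by blast
    qed
    moreover have "finite {z. (z, y) \<in> l}" by (rule finite_subset[OF _ fin]) (use l'(4) in auto)
    ultimately show ?thesis by (simp add: f_def psubset_card_mono)
  qed
  have "linext P r f"
    unfolding linext_def
  proof (intro conjI inj_onI ballI impI)
    fix x y assume "x \<in> P" "y \<in> P" "f x = f y"
    then show "x = y" using less[of x y] less[of y x] l'(3) unfolding total_on_def by fastforce
  next
    fix x y assume "(x, y) \<in> r"
    then show "f x \<le> f y" using less[of x y] l(2) by (cases "x = y") auto
  qed
  then show ?thesis by blast
qed

lemma linext_subset: "linext X s f \<Longrightarrow> Y \<subseteq> X \<Longrightarrow> linext Y s f"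
  by (auto simp: linext_def intro: inj_on_subset)

text \<open>\<open>B1\<close> puts the up-set of \<open>w\<close> on top of each
  \<open>L1 k\<close>, and \<open>B2\<close> puts the down-set below each \<open>L2 k\<close>. Pairs
  inside one of the smaller posets are reversed there. The mixed pairs are reversed by every
  \<open>B1 k\<close> or by every \<open>B2 k\<close>, and \<open>e\<close> positive ensures that
  there is one.\<close>

lemma dim_le_remove_vertex:
  assumes C: "C \<subseteq> P" and w: "w \<in> C" and e: "0 < e"
    and d1: "dim_le {x \<in> C. (w, x) \<notin> r} r e" and d2: "dim_le {x \<in> C. (x, w) \<notin> r} r e"
  shows "dim_le C r (2 * e)"
proof -
  from d1 obtain L1 where L1: "\<And>k. k < e \<Longrightarrow> linext {x \<in> C. (w, x) \<notin> r} r (L1 k)"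
    and rev1: "\<And>x y. x \<in> {x \<in> C. (w, x) \<notin> r} \<Longrightarrow> y \<in> {x \<in> C. (w, x) \<notin> r} \<Longrightarrow> (x, y) \<notin> r \<Longrightarrow>
      \<exists>k<e. L1 k y < L1 k x"
    unfolding dim_le_def by blast
  from d2 obtain L2 where L2: "\<And>k. k < e \<Longrightarrow> linext {x \<in> C. (x, w) \<notin> r} r (L2 k)"
    and rev2: "\<And>x y. x \<in> {x \<in> C. (x, w) \<notin> r} \<Longrightarrow> y \<in> {x \<in> C. (x, w) \<notin> r} \<Longrightarrow> (x, y) \<notin> r \<Longrightarrow>
      \<exists>k<e. L2 k y < L2 k x"
    unfolding dim_le_def by blast
  obtain g where "linext P r g" using linext_exists by blast
  then have g: "linext C r g" using C by (rule linext_subset)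
  have finC: "finite C" using C fin finite_subset by blast
  define B1 where "B1 k = lex_rank C (\<lambda>x. if (w, x) \<in> r then 1 else 0)
    (\<lambda>x. if (w, x) \<in> r then g x else L1 k x)" for k
  define B2 where "B2 k = lex_rank C (\<lambda>x. if (x, w) \<in> r then 0 else 1)
    (\<lambda>x. if (x, w) \<in> r then g x else L2 k x)" for k
  have lin1: "linext C r (B1 k)" if "k < e" for k
    unfolding B1_def
  proof (rule linext_lex_rank[OF finC])
    show "inj_on (\<lambda>x. (if (w, x) \<in> r then 1 else 0 :: int, if (w, x) \<in> r then g x else L1 k x)) C"
      using g L1[OF that] by (auto simp: linext_def inj_on_def)
    fix x y assume xy: "x \<in> C" "y \<in> C" "(x, y) \<in> r"
    have "(w, y) \<in> r" if "(w, x) \<in> r" using that xy trans_r by blast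
    then show "(if (w, x) \<in> r then 1 else 0 :: int) < (if (w, y) \<in> r then 1 else 0) \<or>
      (if (w, x) \<in> r then 1 else 0 :: int) = (if (w, y) \<in> r then 1 else 0) \<and>
      (if (w, x) \<in> r then g x else L1 k x) \<le> (if (w, y) \<in> r then g y else L1 k y)"
      using g L1[OF that] xy by (auto simp: linext_def)
  qed
  have lin2: "linext C r (B2 k)" if "k < e" for k
    unfolding B2_def
  proof (rule linext_lex_rank[OF finC])
    show "inj_on (\<lambda>x. (if (x, w) \<in> r then 0 else 1 :: int, if (x, w) \<in> r then g x else L2 k x)) C"
      using g L2[OF that] by (auto simp: linext_def inj_on_def)
    fix x y assume xy: "x \<in> C" "y \<in> C" "(x, y) \<in> r"
    have "(x, w) \<in> r" if "(y, w) \<in> r" using that xy trans_r by blast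
    then show "(if (x, w) \<in> r then 0 else 1 :: int) < (if (y, w) \<in> r then 0 else 1) \<or>
      (if (x, w) \<in> r then 0 else 1 :: int) = (if (y, w) \<in> r then 0 else 1) \<and>
      (if (x, w) \<in> r then g x else L2 k x) \<le> (if (y, w) \<in> r then g y else L2 k y)"
      using g L2[OF that] xy by (auto simp: linext_def)
  qed
  define L where "L k = (if k < e then B1 k else B2 (k - e))" for k
  have "linext C r (L k)" if "k < 2 * e" for k
    using lin1[of k] lin2[of "k - e"] that by (auto simp: L_def)
  moreover have "\<exists>k<2 * e. L k y < L k x" if xy: "x \<in> C" "y \<in> C" "(x, y) \<notin> r" for x y
  proof -
    have 1: ?thesis if "k < e" "B1 k y < B1 k x" for k
      using that by (intro exI[of _ k]) (simp add: L_def)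
    have 2: ?thesis if "k < e" "B2 k y < B2 k x" for k
      using that by (intro exI[of _ "e + k"]) (simp add: L_def)
    \<comment> \<open>If all four cases failed, \<open>x\<close> would be below \<open>w\<close> and
      \<open>w\<close> below \<open>y\<close>.\<close>
    consider "(w, x) \<notin> r" "(w, y) \<notin> r" | "(x, w) \<notin> r" "(y, w) \<notin> r" | "(w, x) \<in> r" "(w, y) \<notin> r"
      | "(x, w) \<notin> r" "(y, w) \<in> r"
      using xy(3) trans_r by blast
    then show ?thesis
    proof cases
      case a: 1
      then obtain k where "k < e" "L1 k y < L1 k x" using rev1[of x y] xy by auto
      then show ?thesis using a xy finC by (intro 1[of k]) (auto simp: B1_def lex_rank_less_iff)
    next
      case a: 2
      then obtain k where "k < e" "L2 k y < L2 k x" using rev2[of x y] xy by auto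
      then show ?thesis using a xy finC by (intro 2[of k]) (auto simp: B2_def lex_rank_less_iff)
    next
      case 3
      then show ?thesis using xy finC e by (intro 1[of 0]) (auto simp: B1_def lex_rank_less_iff)
    next
      case 4
      then show ?thesis using xy finC e by (intro 2[of 0]) (auto simp: B2_def lex_rank_less_iff)
    qed
  qed
  ultimately show ?thesis unfolding dim_le_def by blast
qed

text \<open>A condition on vertex sets, that is, on induced subgraphs; it passes to subsets.\<close>

definition centered :: "'a set \<Rightarrow> ('a \<Rightarrow> nat) \<Rightarrow> bool" where
  "centered X c \<longleftrightarrow> (\<forall>H\<subseteq>X. biconn H \<longrightarrow> (\<exists>k. \<exists>!v. v \<in> H \<and> c v = k))"

text \<open>Forces the ends of an edge to get different colours, which settles the case of one
  colour.\<close>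

lemma biconn_edge:
  assumes "adj x y"
  shows "biconn {x, y}"
proof -
  have s: "\<not> separation A B {z}" for A B z
    unfolding separation_def by (metis UnI1 UnI2 singletonD disjoint_iff ex_in_conv)
  have "\<not> separation A B {x, y}" for A B
  proof
    assume "separation A B {x, y}"
    then have "x \<in> A \<and> y \<in> B \<or> x \<in> B \<and> y \<in> A \<or> A = {} \<or> B = {}"
      by (auto simp: separation_def)
    then show False using \<open>separation A B {x, y}\<close> assms adj_sym[OF assms] by (auto simp: separation_def)
  qed
  moreover have "{x, y} - {x} = {y}" "{x, y} - {y} = {x}"
    using assms by (auto simp: adj_def covers_def)
  ultimately show ?thesis using s by (auto simp: biconn_def conn_def)
qed

lemma dim_le_coloring:
  assumes "order_convex X" "card (c ` X) \<le> m" "centered X c"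
  shows "dim_le X r (2 ^ (m + 1) - 2)"
  using assms
proof (induction m arbitrary: X)
  case 0
  have "finite X" using 0(1) fin finite_subset by (auto simp: order_convex_def)
  then have "X = {}" using 0(2) by auto
  then show ?case by (simp add: dim_le_def)
next
  case (Suc n)
  have XP: "X \<subseteq> P" using Suc.prems(1) by (auto simp: order_convex_def)
  then have finX: "finite X" using fin finite_subset by blast
  show ?case
  \<comment> \<open>One colour is treated apart: the bound for blocks would be 0, while
    \<open>rooted_blocks\<close> asks for a positive \<open>d\<close>.\<close>
  proof (cases "n = 0")
    case True
    have anti: "x = y" if xy: "x \<in> X" "y \<in> X" "(x, y) \<in> r" for x y
    proof (rule ccontr)
      assume "x \<noteq> y"
      then obtain z where z: "covers P r z x" "(z, y) \<in> r" using cover_above xy(3) by blast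
      then have zX: "z \<in> X" "x \<noteq> z"
        using Suc.prems(1) xy unfolding order_convex_def covers_def by blast+
      have "biconn {x, z}" using z(1) by (intro biconn_edge) (auto simp: adj_def)
      then obtain k where k: "\<exists>!v. v \<in> {x, z} \<and> c v = k"
        using Suc.prems(3) zX xy unfolding centered_def by (metis empty_subsetI insert_subset)
      have "card (c ` X) \<le> Suc 0" using Suc.prems(2) True by simp
      then have "\<forall>a\<in>c ` X. \<forall>b\<in>c ` X. a = b"
        by (rule iffD1[OF card_le_Suc0_iff_eq[OF finite_imageI[OF finX]]])
      then have cc: "c x = c z" using xy zX by blast
      from k obtain u where u0: "u \<in> {x, z}" "c u = k"
        and u: "\<And>v. v \<in> {x, z} \<Longrightarrow> c v = k \<Longrightarrow> v = u"
        by (elim ex1E) blast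
      have "c x = k" "c z = k" using u0 cc by auto
      then show False using u[of x] u[of z] zX(2) by simp
    qed
    obtain f where "linext P r f" using linext_exists by blast
    then have f: "linext X r f" using XP by (rule linext_subset)
    \<comment> \<open>\<open>X\<close> is an antichain, so the reverse of \<open>f\<close> is a
      linear extension too; these two labellings match \<open>2 ^ 2 - 2\<close>.\<close>
    define L where "L k = (if k = 0 then f else (\<lambda>x. - f x))" for k :: nat
    have "linext X r (L k)" for k
      using f anti by (auto simp: L_def linext_def inj_on_def)
    moreover have "\<exists>k<2. L k y < L k x" if "x \<in> X" "y \<in> X" "(x, y) \<notin> r" for x y
    proof -
      have "x \<noteq> y" using that XP refl_r by auto
      then have "f x \<noteq> f y" using f that by (auto simp: linext_def inj_on_def)
      then consider "f y < f x" | "f x < f y" by linarith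
      then show ?thesis
      proof cases
        case 1
        then show ?thesis by (intro exI[of _ 0]) (simp add: L_def)
      next
        case 2
        then show ?thesis by (intro exI[of _ 1]) (simp add: L_def)
      qed
    qed
    ultimately have "dim_le X r 2" unfolding dim_le_def by blast
    then show ?thesis using True by simp
  next
    case False
    define e where "e = (2::nat) ^ (n + 1) - 2"
    \<comment> \<open>Makes \<open>e\<close> positive and the truncated subtraction exact.\<close>
    have "(2::nat) ^ (n + 1) > 2 ^ 1" using False by (intro power_strict_increasing) auto
    then have e: "0 < e" "2 * e + 2 = 2 ^ (Suc n + 1) - 2" by (auto simp: e_def)
    have blocks: "dim_le C r (2 * e)" if C: "C \<subseteq> X" "order_convex C" "biconn C" for C
    proof -
      have CP: "C \<subseteq> P" using C XP by blast
      have "\<exists>k. \<exists>!v. v \<in> C \<and> c v = k" using Suc.prems(3) C(1,3) by (simp add: centered_def)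
      then obtain k w where w: "w \<in> C" "c w = k"
        and uniq: "\<And>v. v \<in> C \<Longrightarrow> c v = k \<Longrightarrow> v = w"
        by (elim exE ex1E) blast
      \<comment> \<open>Without \<open>w\<close> the colour \<open>k\<close> is missing on
        \<open>D\<close>, so one colour fewer remains.\<close>
      have sub: "dim_le D r e" if D: "D \<subseteq> C" "w \<notin> D" "order_convex D" for D
        unfolding e_def
      proof (rule Suc.IH[OF D(3)])
        have "c ` D \<subseteq> c ` X - {k}" using D C uniq by auto
        then have "card (c ` D) \<le> card (c ` X - {k})" using finX by (intro card_mono) auto
        also have "\<dots> = card (c ` X) - 1" using w C by (auto simp: card_Diff_singleton)
        finally show "card (c ` D) \<le> n" using Suc.prems(2) by simp
        show "centered D c" using Suc.prems(3) D C unfolding centered_def by (meson order_trans)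
      qed
      have ww: "(w, w) \<in> r" using w CP refl_r by blast
      \<comment> \<open>Removing an up-set or a down-set preserves convexity.\<close>
      have "order_convex {x \<in> C. (w, x) \<notin> r}" "order_convex {x \<in> C. (x, w) \<notin> r}"
        using C(2) trans_r unfolding order_convex_def by blast+
      then show ?thesis using ww by (intro dim_le_remove_vertex[OF CP w(1) e(1)] sub) auto
    qed
    show ?thesis
    proof (cases "X = {}")
      case True
      then show ?thesis by (simp add: dim_le_def linext_def)
    next
      case False
      then obtain v where "v \<in> X" by blast
      then have "rooted r (2 * e) X v" using e blocks Suc.prems(1) by (intro rooted_blocks) auto
      then have "dim_le X r (2 * e + 2)" by (rule rooted_dim_le)
      then show ?thesis by (simp only: e)
    qed
  qed
qed

text \<open>Different labellings may define the same linear order, so the realizer has at most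
  \<open>d\<close> members.\<close>

lemma poset_dim_le:
  assumes "dim_le P r d"
  shows "poset_dim P r \<le> d"
proof -
  from assms obtain L where L: "\<And>k. k < d \<Longrightarrow> linext P r (L k)"
    and rev: "\<And>x y. x \<in> P \<Longrightarrow> y \<in> P \<Longrightarrow> (x, y) \<notin> r \<Longrightarrow> \<exists>k<d. L k y < L k x"
    unfolding dim_le_def by blast
  define l where "l k = {(x, y). x \<in> P \<and> y \<in> P \<and> L k x \<le> L k y}" for k
  have "linear_order_on P (l k)" if "k < d" for k
    using L[OF that]
    by (auto simp: order_on_defs l_def refl_on_def trans_def antisym_def total_on_def linext_def inj_on_def)
  moreover have "(x, y) \<in> r \<longleftrightarrow> (\<forall>k<d. (x, y) \<in> l k)" if xy: "x \<in> P" "y \<in> P" for x y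
  proof
    assume "(x, y) \<in> r"
    then show "\<forall>k<d. (x, y) \<in> l k" using L xy by (auto simp: l_def linext_def)
  next
    assume "\<forall>k<d. (x, y) \<in> l k"
    then show "(x, y) \<in> r" using rev[OF xy] by (force simp: l_def)
  qed
  ultimately have "realizer P r (l ` {..<d})" unfolding realizer_def by auto
  then have "poset_dim P r \<le> card (l ` {..<d})"
    unfolding poset_dim_def by (intro Least_le) blast
  also have "\<dots> \<le> d" using card_image_le[of "{..<d}" l] by simp
  finally show ?thesis .
qed

section \<open>Transfer to the graph library\<close>

definition induced :: "'a set \<Rightarrow> 'a pair_pre_digraph" where
  "induced H = \<lparr> pverts = H, parcs = {(x, y). x \<in> H \<and> y \<in> H \<and> adj x y} \<rparr>"

lemma induced_simps [simp]:
  "pverts (induced H) = H" "parcs (induced H) = {(x, y). x \<in> H \<and> y \<in> H \<and> adj x y}"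
  by (simp_all add: induced_def)

lemma pair_graph_induced:
  assumes "finite H"
  shows "pair_graph (induced H)"
proof unfold_locales
  show "finite (parcs (induced H))"
    by (rule finite_subset[of _ "H \<times> H"]) (auto simp: assms)
qed (auto simp: adj_def covers_def symmetric_def assms intro!: symI)

text \<open>The vertices reachable from \<open>u\<close> and the remaining ones would form a
  separation.\<close>

lemma strongly_connected_induced:
  assumes fin: "finite H" and ne: "H \<noteq> {}" and con: "conn H"
  shows "strongly_connected (with_proj (induced H))"
proof (rule strongly_connectedI)
  interpret pair_graph "induced H" using fin by (rule pair_graph_induced)
  have wf: "wf_digraph (with_proj (induced H))" by unfold_locales
  show "verts (with_proj (induced H)) \<noteq> {}" using ne by simp
  fix u v assume uv: "u \<in> verts (with_proj (induced H))" "v \<in> verts (with_proj (induced H))"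
  show "u \<rightarrow>\<^sup>*\<^bsub>with_proj (induced H)\<^esub> v"
  proof (rule ccontr)
    assume no: "\<not> ?thesis"
    let ?A = "{y \<in> H. u \<rightarrow>\<^sup>*\<^bsub>with_proj (induced H)\<^esub> y}"
    have "separation ?A (H - ?A) H"
      unfolding separation_def
    proof (intro conjI ballI)
      have "u \<in> ?A" using uv by simp
      then show "?A \<noteq> {}" by blast
      show "H - ?A \<noteq> {}" using no uv by auto
      fix a b assume ab: "a \<in> ?A" "b \<in> H - ?A"
      show "\<not> adj a b"
      proof
        assume "adj a b"
        then have e: "a \<rightarrow>\<^bsub>with_proj (induced H)\<^esub> b" using ab by simp
        have "u \<rightarrow>\<^sup>*\<^bsub>with_proj (induced H)\<^esub> b"
          by (rule wf_digraph.reachable_adj_trans[OF wf _ e]) (use ab in simp)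
        then show False using ab by blast
      qed
    qed auto
    then show False using con by (auto simp: conn_def)
  qed
qed

lemma del_vert_induced:
  "pre_digraph.del_vert (with_proj (induced H)) w = with_proj (induced (H - {w}))"
  by (auto simp: pre_digraph.del_vert_def with_proj_def)

text \<open>Deleting a vertex of a \<open>biconn\<close> set leaves one component, or none if it was
  the only vertex; the count never grows, so there is no cutvertex.\<close>

lemma card_sccs_induced:
  assumes "finite H" "conn H"
  shows "card (pre_digraph.sccs (with_proj (induced H))) = (if H = {} then 0 else 1)"
proof -
  interpret pair_graph "induced H" using assms(1) by (rule pair_graph_induced)
  show ?thesis
  proof (cases "H = {}")
    case True
    have "sccs = {}"
      using True by (auto simp: pre_digraph.sccs_def strongly_connected_def induced_subgraph_def subgraph_def)
    then show ?thesis using True by simp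
  next
    case False
    then have "sccs = {with_proj (induced H)}"
      using strongly_connected_induced[OF assms(1) _ assms(2)] strongly_connected_eq_iff by blast
    then show ?thesis using False by simp
  qed
qed

lemma centered_if_two_connected_centered:
  assumes c: "two_connected_centered_coloring (with_proj (cover_graph P r)) c"
  shows "centered P c"
  unfolding centered_def
proof (intro allI impI)
  fix H assume H: "H \<subseteq> P" "biconn H"
  have finH: "finite H" using H(1) fin finite_subset by blast
  interpret H: pair_graph "induced H" using finH by (rule pair_graph_induced)
  interpret G: pair_graph "cover_graph P r" using fin by (rule pair_graph_cover_graph)
  let ?K = "with_proj (induced H)"
  have "subgraph ?K (with_proj (cover_graph P r))"
    unfolding subgraph_def compatible_def
    using H(1) H.wf_digraph_axioms G.wf_digraph_axioms
    by (auto simp: cover_graph_def adj_def)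
  moreover have "graph ?K" by unfold_locales
  moreover have "connected ?K"
  proof -
    have "strongly_connected ?K"
      using H by (intro strongly_connected_induced finH) (auto simp: biconn_def)
    \<comment> \<open>\<open>connected\<close> speaks of the symmetric closure, to which
      reachability carries over.\<close>
    then show ?thesis
      unfolding connected_def strongly_connected_def
      using H.reachable_mk_symmetricI by simp
  qed
  moreover have "\<not> cutvertex ?K w" for w
  proof
    assume "cutvertex ?K w"
    then have w: "w \<in> H" and less: "card (pre_digraph.sccs ?K) < card (pre_digraph.sccs (with_proj (induced (H - {w}))))"
      by (auto simp: cutvertex_def del_vert_induced)
    have "conn H" "conn (H - {w})" using H(2) w by (auto simp: biconn_def)
    then show False using less w finH by (auto simp: card_sccs_induced split: if_splits)
  qed
  moreover from c have "subgraph ?K (with_proj (cover_graph P r)) \<and> graph ?K \<and> connected ?K \<and>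
      (\<nexists>v. cutvertex ?K v) \<longrightarrow> (\<exists>k. \<exists>!v. v \<in> verts ?K \<and> c v = k)"
    unfolding two_connected_centered_coloring_def by (rule spec)
  ultimately show "\<exists>k. \<exists>!v. v \<in> H \<and> c v = k" by simp
qed

end

theorem theorem4:
  fixes P :: "'a set" and r :: "'a rel" and G :: "'a pair_pre_digraph" and m :: nat
  assumes "finite P" and "partial_order_on P r"
    and "G = cover_graph P r"
    and "m = td2 (with_proj G)"
  shows "poset_dim P r \<le> 2 ^ (m + 1) - 2"
proof -
  interpret finite_poset P r using assms by unfold_locales
  have verts: "verts (with_proj G) = P" using assms(3) by (simp add: cover_graph_def)
  have "\<exists>c. two_connected_centered_coloring (with_proj G) c"
    using two_connected_centered_coloring_exists[of "with_proj G"] verts assms(1) by simp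
  \<comment> \<open>Some colouring exists, so the minimum in \<open>td2\<close> is attained.\<close>
  then have "\<exists>n c. two_connected_centered_coloring (with_proj G) c \<and> card (c ` verts (with_proj G)) = n"
    by blast
  then have "\<exists>c. two_connected_centered_coloring (with_proj G) c \<and> card (c ` verts (with_proj G)) = m"
    unfolding assms(4) td2_def by (rule LeastI_ex)
  then obtain c where c: "two_connected_centered_coloring (with_proj G) c" "card (c ` P) = m"
    using verts by auto
  have "order_convex P" using in_P by (auto simp: order_convex_def)
  then have "dim_le P r (2 ^ (m + 1) - 2)"
    using c assms(3) by (intro dim_le_coloring centered_if_two_connected_centered) auto
  then show ?thesis by (rule poset_dim_le)
qed

end
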